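(* The following algorithm, on input a finite set of graphs $\mathcal{F}=\{F_1,\dots,F_n\}$, always terminates and outputs "yes" if and only if the speed of $\mathcal{X}=\mathrm{Free}(\mathcal{F})$ is above the Bell number. (1) Decide whether $k_{\mathcal{X}}=\infty$; if so, output "yes" and stop. (2) Set $m:=\max\{|F_1|,\dots,|F_n|\}$ and $\ell:=1$. (3) Loop: (3a) for each graph $H$ with loops allowed on $\{1,\dots,\ell\}$, construct the $(\ell,\ell)$-strip $S_{H,\ell}$ and check whether some $F_i$ is an induced subgraph of it; if for every such $H$ the strip $S_{H,\ell}$ contains some $F_i$, output "no" and stop. (3b) For each graph $H$ with loops allowed on $\{1,\dots,\ell\}$ and each word $w$ consisting of $\ell$ distinct letters from $\{1,\dots,\ell\}$, check whether $G_{w^\infty,H}(1,2,\dots,2\ell m)$ contains some $F_i$ as an induced subgraph; if one of these graphs contains no $F_i$, output "yes" and stop. (3c) Set $\ell:=\ell+1$ and repeat.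
   Context: $\mathrm{Free}(\mathcal{F})$ is the class of finite simple graphs with no induced subgraph isomorphic to a member of $\mathcal{F}$. Speed: number of graphs in the class on vertex set $\{1,\dots,n\}$; above the Bell number means speed $\ge n^{(1-o(1))n}$ (equivalently at least the Bell number $B_n$). Distinguishing number $k_{\mathcal{X}}$: for $X\subseteq V(G)$, disjoint sets $U_1,\dots,U_m$ are distinguished by $X$ if vertices in the same $U_i$ have equal neighbourhoods in $X$ and vertices in different $U_i$ different ones; $k_{\mathcal{X}}=\infty$ iff for all $k,m$ some $G\in\mathcal{X}$ and $X\subseteq V(G)$ distinguish at least $m$ sets of size at least $k$ (whether this holds is decidable for finite $\mathcal{F}$). For a finite word $w$, $w^\infty$ is the infinite word obtained by concatenating infinitely many copies of $w$. For a graph $H$ with loops allowed on alphabet $A$, a word $v$ over $A$ and positive integers $u_1<\dots<u_k$, $G_{v,H}(u_1,\dots,u_k)$ has vertex set $\{u_i\}$ and $u_iu_j$ is an edge iff ($|u_i-u_j|=1$ and $v_{u_i}v_{u_j}\notin E(H)$) or ($|u_i-u_j|>1$ and $v_{u_i}v_{u_j}\in E(H)$) (a loop at $a$ handles equal letters $a$). For $H$ with loops allowed on $\{1,\dots,\ell\}$ and $m\ge1$, the $(\ell,m)$-strip $S_{H,m}$ has vertex set $\{1,\dots,\ell\}\times\{1,\dots,m\}$, distinct $(a,j),(b,k)$ adjacent iff either $ab\in E(H)$ and ($|a-b|\ne1$ or $j\ne k$), or $ab\notin E(H)$, $|a-b|=1$ and $j=k$. *)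

theory Defs
  imports Complex_Main
begin

definition simple_graph :: "'a set \<Rightarrow> 'a set set \<Rightarrow> bool" where
  "simple_graph V E \<longleftrightarrow> finite V \<and> E \<subseteq> {{x, y} | x y. x \<in> V \<and> y \<in> V \<and> x \<noteq> y}"

definition induced_sub :: "'a set \<times> 'a set set \<Rightarrow> 'b set \<times> 'b set set \<Rightarrow> bool" where
  "induced_sub F G \<longleftrightarrow> (\<exists>f. inj_on f (fst F) \<and> f ` fst F \<subseteq> fst G \<and>
     (\<forall>x\<in>fst F. \<forall>y\<in>fst F. ({x, y} \<in> snd F \<longleftrightarrow> {f x, f y} \<in> snd G)))"

text \<open>Membership in Free(Fs) (graphs with vertices in nat; the class is closed under isomorphism).\<close>
definition in_Free :: "(nat set \<times> nat set set) list \<Rightarrow> nat set \<Rightarrow> nat set set \<Rightarrow> bool" where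
  "in_Free Fs V E \<longleftrightarrow> simple_graph V E \<and> (\<forall>F\<in>set Fs. \<not> induced_sub F (V, E))"

definition speed :: "(nat set \<times> nat set set) list \<Rightarrow> nat \<Rightarrow> nat" where
  "speed Fs n = card {E. in_Free Fs {1..n} E}"

text \<open>Speed above the Bell number: speed n \<ge> n^((1-o(1))n).\<close>
definition above_Bell :: "(nat set \<times> nat set set) list \<Rightarrow> bool" where
  "above_Bell Fs \<longleftrightarrow> (\<forall>\<epsilon>>0. \<forall>\<^sub>F n in sequentially.
      real (speed Fs n) \<ge> real n powr ((1 - \<epsilon>) * real n))"

definition k_infinite :: "(nat set \<times> nat set set) list \<Rightarrow> bool" where
  "k_infinite Fs \<longleftrightarrow> (\<forall>k m. \<exists>V E X (U :: nat \<Rightarrow> nat set).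
      in_Free Fs V E \<and> X \<subseteq> V \<and>
      (\<forall>i<m. U i \<subseteq> V - X \<and> card (U i) \<ge> k) \<and>
      (\<forall>i<m. \<forall>j<m. i \<noteq> j \<longrightarrow> U i \<inter> U j = {}) \<and>
      (\<forall>i<m. \<forall>x\<in>U i. \<forall>y\<in>U i. {z\<in>X. {x, z} \<in> E} = {z\<in>X. {y, z} \<in> E}) \<and>
      (\<forall>i<m. \<forall>j<m. i \<noteq> j \<longrightarrow> (\<forall>x\<in>U i. \<forall>y\<in>U j. {z\<in>X. {x, z} \<in> E} \<noteq> {z\<in>X. {y, z} \<in> E})))"

text \<open>A graph with loops allowed on {1..l}: edge set of 1- or 2-element subsets (singletons = loops).\<close>
definition loop_graph :: "nat \<Rightarrow> nat set set \<Rightarrow> bool" where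
  "loop_graph l HE \<longleftrightarrow> HE \<subseteq> {{a, b} | a b. a \<in> {1..l} \<and> b \<in> {1..l}}"

definition dist1 :: "nat \<Rightarrow> nat \<Rightarrow> bool" where
  "dist1 a b \<longleftrightarrow> a = b + 1 \<or> b = a + 1"

definition strip_adj :: "nat set set \<Rightarrow> nat \<times> nat \<Rightarrow> nat \<times> nat \<Rightarrow> bool" where
  "strip_adj HE u v \<longleftrightarrow> (case u of (a, j) \<Rightarrow> case v of (b, k) \<Rightarrow>
     ({a, b} \<in> HE \<and> (\<not> dist1 a b \<or> j \<noteq> k)) \<or> ({a, b} \<notin> HE \<and> dist1 a b \<and> j = k))"

definition strip :: "nat \<Rightarrow> nat set set \<Rightarrow> nat \<Rightarrow> (nat \<times> nat) set \<times> (nat \<times> nat) set set" where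
  "strip l HE m = ({1..l} \<times> {1..m},
     {{u, v} | u v. u \<in> {1..l} \<times> {1..m} \<and> v \<in> {1..l} \<times> {1..m} \<and> u \<noteq> v \<and> strip_adj HE u v})"

text \<open>G_{v,H}(U) for an (infinite) word v indexed from 1 and a finite set U of positive integers.\<close>
definition word_graph :: "(nat \<Rightarrow> 'b) \<Rightarrow> 'b set set \<Rightarrow> nat set \<Rightarrow> nat set \<times> nat set set" where
  "word_graph v HE U = (U, {{x, y} | x y. x \<in> U \<and> y \<in> U \<and> x \<noteq> y \<and>
     ((dist1 x y \<and> {v x, v y} \<notin> HE) \<or> (\<not> dist1 x y \<and> {v x, v y} \<in> HE))})"

definition word_inf :: "'b list \<Rightarrow> nat \<Rightarrow> 'b" where
  "word_inf w p = w ! ((p - 1) mod length w)"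

definition max_order :: "(nat set \<times> nat set set) list \<Rightarrow> nat" where
  "max_order Fs = foldr max (map (\<lambda>F. card (fst F)) Fs) 0"

definition stop_no :: "(nat set \<times> nat set set) list \<Rightarrow> nat \<Rightarrow> bool" where
  "stop_no Fs l \<longleftrightarrow> (\<forall>HE. loop_graph l HE \<longrightarrow> (\<exists>F\<in>set Fs. induced_sub F (strip l HE l)))"

definition stop_yes :: "(nat set \<times> nat set set) list \<Rightarrow> nat \<Rightarrow> bool" where
  "stop_yes Fs l \<longleftrightarrow> (\<exists>HE w. loop_graph l HE \<and> length w = l \<and> distinct w \<and> set w \<subseteq> {1..l} \<and>
     (\<forall>F\<in>set Fs. \<not> induced_sub F (word_graph (word_inf w) HE {1..2 * l * max_order Fs})))"

text \<open>Result of the algorithm: None = does not terminate, Some True = "yes", Some False = "no".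
  Within one iteration step (3a) is performed before (3b).\<close>
definition algorithm :: "(nat set \<times> nat set set) list \<Rightarrow> bool option" where
  "algorithm Fs = (if k_infinite Fs then Some True
     else if \<exists>l\<ge>1. stop_no Fs l \<or> stop_yes Fs l
     then Some (\<not> stop_no Fs (LEAST l. l \<ge> 1 \<and> (stop_no Fs l \<or> stop_yes Fs l)))
     else None)"

end

theory Submission
  imports Defs "HOL-Library.FuncSet" "HOL-Library.Nat_Bijection" "HOL-Combinatorics.Permutations"
begin

text \<open>If \<open>k\<close> is infinite, \<open>t\<close> large classes are separated by at most \<open>t\<close> vertices, so any map from the
  remaining labels to the \<open>t\<close> classes yields a different labelled graph; \<open>t\<close> slightly below \<open>n\<close>
  gives the Bell growth. If a graph of a periodic word with distinct letters is \<open>Fs\<close>-free up to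
  length \<open>2lm\<close>, all its induced subgraphs are, and up to exponentially many choices the labelled
  graph remembers the order of its vertices, so there are about \<open>n!\<close> of them.

  If \<open>k\<close> is finite, every graph of the class becomes a graph of bounded degree after complementing
  the edges between some of boundedly many colour classes. A long induced path in this flip, cut
  into blocks with equal colour words, contains an \<open>(L, L)\<close>-strip. Hence when all \<open>(L, L)\<close>-strips are
  forbidden the components have at most \<open>M\<close> vertices, and there are only
  \<open>C\<^sup>n n\<^bsup>(1 - 1/M)n\<^esup>\<close> graphs. When strips of all sizes occur, the finiteness of \<open>k\<close> bounds the
  number of distinct rows of \<open>H\<close>, so in a long strip some window of \<open>m\<close> rows repeats and the part
  between the two occurrences is the period of a word graph accepted in step (3b).\<close>

section \<open>Graphs, embeddings and separating sets\<close>

text \<open>In \<open>k_infinite\<close> nothing bounds the separating set \<open>X\<close>, and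
  every label spent on it is lost for counting. So \<open>X\<close> is first thinned out to at most
  \<open>t\<close> vertices. The flip exists because of a dichotomy: putting a vertex into
  \<open>X\<close> either splits some class into two large parts, or the vertex is almost complete
  or almost anticomplete to each class. A split may halve all classes, so the sizes demanded at
  successive levels differ by a factor of about two (\<open>threshold\<close>), and finiteness of k
  ends the process after boundedly many levels. An induced path in the flip is a vertex sequence
  along which adjacency follows the colour relation, except that it is reversed for consecutive
  vertices. Strips and word graphs have this same reversal built in, which lets paths, strips and
  words be exchanged. A word graph sees only letters and consecutiveness, so each of the at most m
  vertices of a forbidden graph costs at most 2l positions; this is the 2lm of step (3b). The saving
  1/M in the exponent arises because at least n/M vertices represent their own component and need no
  pointer.\<close>

lemma dist1_commute: "dist1 a b \<longleftrightarrow> dist1 b a"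
  by (auto simp: dist1_def)

lemma doubleton_in_edges_iff:
  assumes "\<And>x y. P x y \<Longrightarrow> P y x"
  shows "{a, b} \<in> {{x, y} | x y. x \<in> A \<and> y \<in> A \<and> x \<noteq> y \<and> P x y}
    \<longleftrightarrow> a \<in> A \<and> b \<in> A \<and> a \<noteq> b \<and> P a b"
  using assms by (auto simp: doubleton_eq_iff)

lemma simple_graph_loopless: "simple_graph V E \<Longrightarrow> {x} \<notin> E"
  by (auto simp: simple_graph_def doubleton_eq_iff)

lemma induced_sub_trans:
  assumes "induced_sub F G" "induced_sub G H"
  shows "induced_sub F H"
proof -
  from assms(1) obtain f where f: "inj_on f (fst F)" "f ` fst F \<subseteq> fst G"
    "\<And>x y. x \<in> fst F \<Longrightarrow> y \<in> fst F \<Longrightarrow> {x, y} \<in> snd F \<longleftrightarrow> {f x, f y} \<in> snd G"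
    unfolding induced_sub_def by blast
  from assms(2) obtain g where g: "inj_on g (fst G)" "g ` fst G \<subseteq> fst H"
    "\<And>x y. x \<in> fst G \<Longrightarrow> y \<in> fst G \<Longrightarrow> {x, y} \<in> snd G \<longleftrightarrow> {g x, g y} \<in> snd H"
    unfolding induced_sub_def by blast
  show ?thesis unfolding induced_sub_def
  proof (intro exI[of _ "g \<circ> f"] conjI ballI)
    show "inj_on (g \<circ> f) (fst F)"
      using f g by (meson comp_inj_on inj_on_subset)
    show "(g \<circ> f) ` fst F \<subseteq> fst H" using f(2) g(2) by auto
    show "{x, y} \<in> snd F \<longleftrightarrow> {(g \<circ> f) x, (g \<circ> f) y} \<in> snd H"
      if "x \<in> fst F" "y \<in> fst F" for x y
    proof -
      have "f x \<in> fst G" "f y \<in> fst G" using f(2) that by auto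
      then show ?thesis using f(3)[OF that] g(3) by simp
    qed
  qed
qed

text \<open>Polymorphic in the vertex type of the host graph, so that it also applies to strips,
  whose vertices are pairs.\<close>

definition free_of :: "('a set \<times> 'a set set) list \<Rightarrow> 'b set \<times> 'b set set \<Rightarrow> bool" where
  "free_of Fs G \<longleftrightarrow> (\<forall>F\<in>set Fs. \<not> induced_sub F G)"

lemma in_Free_iff: "in_Free Fs V E \<longleftrightarrow> simple_graph V E \<and> free_of Fs (V, E)"
  by (simp add: in_Free_def free_of_def)

lemma free_of_induced_sub: "induced_sub G H \<Longrightarrow> free_of Fs H \<Longrightarrow> free_of Fs G"
  unfolding free_of_def using induced_sub_trans by blast

text \<open>Relabelling along \<open>h\<close>; all graphs counted in the lower bounds are pulled
  back from one fixed host graph. The condition \<open>x \<noteq> y\<close> keeps the result simple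
  for every \<open>h\<close>.\<close>

definition pull :: "('a \<Rightarrow> 'b) \<Rightarrow> 'a set \<Rightarrow> 'b set set \<Rightarrow> 'a set set" where
  "pull h A E = {{x, y} | x y. x \<in> A \<and> y \<in> A \<and> x \<noteq> y \<and> {h x, h y} \<in> E}"

lemma doubleton_in_pull_iff:
  "{a, b} \<in> pull h A E \<longleftrightarrow> a \<in> A \<and> b \<in> A \<and> a \<noteq> b \<and> {h a, h b} \<in> E"
  unfolding pull_def by (rule doubleton_in_edges_iff) (simp add: insert_commute)

lemma simple_graph_pull: "finite A \<Longrightarrow> simple_graph A (pull h A E)"
  by (auto simp: simple_graph_def pull_def)

text \<open>\<open>induced_sub\<close> also compares the pair with \<open>x = y\<close>, hence the
  requirement that the host has no singleton edges.\<close>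

lemma induced_sub_pull:
  assumes "inj_on h A" "h ` A \<subseteq> V" "\<And>x. {x} \<notin> E"
  shows "induced_sub (A, pull h A E) (V, E)"
  unfolding induced_sub_def
  using assms by (intro exI[of _ h]) (auto simp: doubleton_in_pull_iff)

lemma in_Free_pull:
  assumes "free_of Fs (V, E)" "inj_on h A" "h ` A \<subseteq> V" "\<And>x. {x} \<notin> E" "finite A"
  shows "in_Free Fs A (pull h A E)"
  unfolding in_Free_iff
  using free_of_induced_sub[OF induced_sub_pull[OF assms(2-4)] assms(1)] simple_graph_pull[OF assms(5)]
  by simp

lemma finite_in_Free: "finite V \<Longrightarrow> finite {E. in_Free Fs V E}"
  by (rule finite_subset[of _ "Pow (Pow V)"]) (auto simp: in_Free_def simple_graph_def)

text \<open>A weak form of Bondy's theorem, which gets by with one point less.\<close>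
lemma separating_subset:
  assumes "finite I" "inj_on f I"
  obtains X where "X \<subseteq> \<Union> (f ` I)" "finite X" "card X \<le> card I" "inj_on (\<lambda>i. f i \<inter> X) I"
proof -
  have "\<exists>X. X \<subseteq> \<Union> (f ` I) \<and> finite X \<and> card X \<le> card I \<and> inj_on (\<lambda>i. f i \<inter> X) I"
    using assms
  proof (induction I rule: finite_induct)
    case empty
    then show ?case by auto
  next
    case (insert j I)
    then obtain X where X: "X \<subseteq> \<Union> (f ` I)" "finite X" "card X \<le> card I"
      "inj_on (\<lambda>i. f i \<inter> X) I" by auto
    show ?case
    proof (cases "\<exists>i\<in>I. f i \<inter> X = f j \<inter> X")
      case False
      then have "inj_on (\<lambda>i. f i \<inter> X) (insert j I)" using X(4) by (auto simp: inj_on_def)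
      then show ?thesis using X insert.hyps by (intro exI[of _ X]) auto
    next
      case True
      \<comment> \<open>Since \<open>X\<close> already separates \<open>I\<close>, only this one
        \<open>i\<close> collides with \<open>j\<close>, so a single further point repairs
        everything.\<close>
      then obtain i where i: "i \<in> I" "f i \<inter> X = f j \<inter> X" by blast
      have "f i \<noteq> f j" using insert.prems insert.hyps i by (auto simp: inj_on_def)
      then obtain x where x: "x \<in> f i \<longleftrightarrow> x \<notin> f j" by blast
      let ?X = "insert x X"
      have "f i' \<inter> ?X \<noteq> f j \<inter> ?X" if "i' \<in> I" for i'
      proof
        assume eq: "f i' \<inter> ?X = f j \<inter> ?X"
        then have "f i' \<inter> X = f j \<inter> X" by blast
        then have "i' = i" using X(4) i that by (auto simp: inj_on_def)
        then show False using eq x by blast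
      qed
      moreover have "inj_on (\<lambda>i. f i \<inter> ?X) I"
      proof (rule inj_onI)
        fix a b assume "a \<in> I" "b \<in> I" and "f a \<inter> ?X = f b \<inter> ?X"
        then have "f a \<inter> X = f b \<inter> X" by blast
        with \<open>a \<in> I\<close> \<open>b \<in> I\<close> X(4) show "a = b" by (auto simp: inj_on_def)
      qed
      ultimately have "inj_on (\<lambda>i. f i \<inter> ?X) (insert j I)"
        by (auto simp: inj_on_def)
      moreover have "card ?X \<le> card (insert j I)"
        using X insert.hyps by (simp add: card_insert_if)
      moreover have "?X \<subseteq> \<Union> (f ` insert j I)" using X(1) x i(1) by auto
      ultimately show ?thesis using X(2) by blast
    qed
  qed
  then show thesis using that by blast
qed

text \<open>The first \<open>c\<close> labels (\<open>c \<le> t\<close>) take the separating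
  vertices. Each other label may be sent to any of the \<open>t\<close> classes, and its neighbours
  among the first \<open>c\<close> labels reveal which one was chosen.\<close>

lemma speed_ge_of_k_infinite:
  assumes "k_infinite Fs" "0 < t" "t \<le> n"
  shows "t ^ (n - t) \<le> speed Fs n"
proof -
  have n: "0 < n" using assms by simp
  \<comment> \<open>Classes of size \<open>n\<close> can host all labels at once, so any choice of
    classes can be realised injectively.\<close>
  from assms(1)[unfolded k_infinite_def, THEN spec[of _ n], THEN spec[of _ t]]
  obtain V E X U where free: "in_Free Fs V E" and "X \<subseteq> V"
    and U: "\<forall>i<t. U i \<subseteq> V - X \<and> card (U i) \<ge> n"
    and disj: "\<forall>i<t. \<forall>j<t. i \<noteq> j \<longrightarrow> U i \<inter> U j = {}"
    and same: "\<forall>i<t. \<forall>x\<in>U i. \<forall>y\<in>U i. {z\<in>X. {x, z} \<in> E} = {z\<in>X. {y, z} \<in> E}"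
    and diff: "\<forall>i<t. \<forall>j<t. i \<noteq> j \<longrightarrow> (\<forall>x\<in>U i. \<forall>y\<in>U j.
        {z\<in>X. {x, z} \<in> E} \<noteq> {z\<in>X. {y, z} \<in> E})"
    by (elim exE conjE) (rule that)
  note U = U[rule_format] and disj = disj[rule_format]
    and same = same[rule_format] and diff = diff[rule_format]
  have sg: "simple_graph V E" and finV: "finite V"
    using free by (auto simp: in_Free_def simple_graph_def)
  have finU: "finite (U i)" if "i < t" for i using U[OF that] finV finite_subset by blast
  have ne: "U i \<noteq> {}" if "i < t" for i using U[OF that] n by auto
  define T where "T i = {z\<in>X. {SOME u. u \<in> U i, z} \<in> E}" for i
  have T: "{z\<in>X. {u, z} \<in> E} = T i" if "i < t" "u \<in> U i" for i u
    unfolding T_def using that ne[OF that(1)] by (intro same[of i]) (auto simp: some_in_eq)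
  have "inj_on T {..<t}"
  proof (rule inj_onI)
    fix i j assume ij: "i \<in> {..<t}" "j \<in> {..<t}" "T i = T j"
    obtain u v where "u \<in> U i" "v \<in> U j" using ne ij by blast
    then show "i = j" using diff[of i j u v] T[of i u] T[of j v] ij by auto
  qed
  then obtain X' where X': "X' \<subseteq> \<Union> (T ` {..<t})" "finite X'" "card X' \<le> card {..<t}"
      "inj_on (\<lambda>i. T i \<inter> X') {..<t}"
    using separating_subset[of "{..<t}" T] by blast
  have X'X: "X' \<subseteq> X" using X'(1) by (auto simp: T_def)
  define c where "c = card X'"
  have ct: "c \<le> t" using X'(3) by (simp add: c_def)
  obtain a where a: "bij_betw a {1..c} X'"
    using ex_bij_betw_nat_finite_1[OF X'(2)] c_def by blast
  have "\<exists>b. \<forall>i<t. inj_on (b i) {1..n} \<and> b i ` {1..n} \<subseteq> U i"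
  proof -
    have "\<exists>b. inj_on b {1..n} \<and> b ` {1..n} \<subseteq> U i" if "i < t" for i
    proof -
      have "card {1..n} \<le> card (U i)" using U[OF that] by simp
      then show ?thesis using card_le_inj[of "{1..n}" "U i"] finU[OF that] by auto
    qed
    then show ?thesis by metis
  qed
  then obtain b where b: "\<And>i. i < t \<Longrightarrow> inj_on (b i) {1..n}"
      "\<And>i x. i < t \<Longrightarrow> x \<in> {1..n} \<Longrightarrow> b i x \<in> U i"
    by (metis image_subset_iff)
  \<comment> \<open>Each class \<open>i\<close> has one fixed injection \<open>b i\<close> of all
    labels, so two labels in the same class never meet, whatever \<open>g\<close> is.\<close>
  define h where "h g x = (if x \<le> c then a x else b (g x) x)" for g x
  let ?D = "{c+1..n} \<rightarrow>\<^sub>E {..<t}"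
  have ha: "h g x \<in> X'" if "x \<in> {1..c}" for g x
    using that a by (auto simp: h_def bij_betw_def)
  have hb: "h g x \<in> U (g x) \<and> g x < t" if "g \<in> ?D" "x \<in> {c+1..n}" for g x
  proof -
    have "g x < t" using that by auto
    then show ?thesis using b(2)[of "g x" x] that by (auto simp: h_def)
  qed
  have inj: "inj_on (h g) {1..n}" if g: "g \<in> ?D" for g
  proof (rule inj_onI)
    fix x y assume x: "x \<in> {1..n}" and y: "y \<in> {1..n}" and eq: "h g x = h g y"
    show "x = y"
    proof (cases "x \<le> c")
      case True
      then have hx: "h g x = a x" "h g x \<in> X" using ha[of x g] X'X x by (auto simp: h_def)
      have "y \<le> c"
      proof (rule ccontr)
        assume "\<not> y \<le> c"
        then have "h g y \<in> V - X" using hb[OF g, of y] U[of "g y"] y by auto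
        with hx eq show False by simp
      qed
      then have "a x = a y" using hx(1) eq by (simp add: h_def)
      moreover have "x \<in> {1..c}" "y \<in> {1..c}" using True \<open>y \<le> c\<close> x y by auto
      ultimately show ?thesis using inj_onD[OF bij_betw_imp_inj_on[OF a]] by blast
    next
      case False
      then have hx: "h g x \<in> U (g x)" "g x < t" "h g x = b (g x) x"
        using hb[OF g, of x] x by (auto simp: h_def)
      have yc: "\<not> y \<le> c"
      proof
        assume "y \<le> c"
        then have "h g y \<in> X" using ha[of y g] X'X y by auto
        moreover have "h g x \<in> V - X" using hx U by auto
        ultimately show False using eq by simp
      qed
      then have hy: "h g y \<in> U (g y)" "g y < t" "h g y = b (g y) y"
        using hb[OF g, of y] y by (auto simp: h_def)
      have "g x = g y"
      proof (rule ccontr)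
        assume "g x \<noteq> g y"
        then have "U (g x) \<inter> U (g y) = {}" using disj hx(2) hy(2) by blast
        then show False using hx(1) hy(1) eq by (metis disjoint_iff)
      qed
      then have "b (g x) x = b (g x) y" using hx(3) hy(3) eq by simp
      then show ?thesis using inj_onD[OF b(1)[OF hx(2)]] x y by blast
    qed
  qed
  have img: "h g ` {1..n} \<subseteq> V" if g: "g \<in> ?D" for g
  proof
    fix y assume "y \<in> h g ` {1..n}"
    then obtain x where x: "x \<in> {1..n}" "y = h g x" by auto
    show "y \<in> V"
    proof (cases "x \<le> c")
      case True
      then show ?thesis using ha[of x g] x X'X \<open>X \<subseteq> V\<close> by auto
    next
      case False
      then show ?thesis using hb[OF g, of x] x U by fastforce
    qed
  qed
  have cn: "c \<le> n" using ct assms by simp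
  have "inj_on (\<lambda>g. pull (h g) {1..n} E) ?D"
  proof (rule inj_onI)
    fix g g' assume g: "g \<in> ?D" and g': "g' \<in> ?D"
      and eq: "pull (h g) {1..n} E = pull (h g') {1..n} E"
    show "g = g'"
    proof (rule PiE_ext[OF g g'])
      fix x assume x: "x \<in> {c+1..n}"
      have key: "a z \<in> T (f x) \<longleftrightarrow> {x, z} \<in> pull (h f) {1..n} E"
        if f: "f \<in> ?D" and z: "z \<in> {1..c}" for f z
      proof -
        have az: "a z \<in> X" "h f z = a z" using a z X'X by (auto simp: bij_betw_def h_def)
        have "a z \<in> T (f x) \<longleftrightarrow> {h f x, h f z} \<in> E"
          using T[of "f x" "h f x"] hb[OF f x] az by auto
        then show ?thesis using x z cn by (auto simp: doubleton_in_pull_iff)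
      qed
      have "T (g x) \<inter> X' = T (g' x) \<inter> X'"
        using key[OF g] key[OF g'] a eq by (auto simp: bij_betw_def)
      moreover have "g x < t" "g' x < t" using hb g g' x by auto
      ultimately show "g x = g' x" using X'(4) by (auto simp: inj_on_def)
    qed
  qed
  moreover have "(\<lambda>g. pull (h g) {1..n} E) ` ?D \<subseteq> {E. in_Free Fs {1..n} E}"
    using in_Free_pull[OF _ inj img] free simple_graph_loopless[OF sg] by (auto simp: in_Free_iff)
  ultimately have "card ?D \<le> speed Fs n"
    unfolding speed_def by (intro card_inj_on_le[OF _ _ finite_in_Free]) auto
  moreover have "card ?D = t ^ (n - c)" by (simp add: card_PiE)
  moreover have "t ^ (n - t) \<le> t ^ (n - c)"
    using ct assms by (intro power_increasing) auto
  ultimately show ?thesis by linarith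
qed

lemma above_Bell_of_k_infinite:
  assumes "k_infinite Fs"
  shows "above_Bell Fs"
  unfolding above_Bell_def
proof (intro allI impI)
  fix \<epsilon> :: real assume "\<epsilon> > 0"
  \<comment> \<open>Half of \<open>\<epsilon>\<close>, because the exponent loses a factor
    \<open>1 - \<delta>\<close> twice: once from \<open>t\<close> against \<open>n\<close>, once
    from \<open>n - t\<close> against \<open>n\<close>. The cap 1/2 keeps
    \<open>1 - \<delta>\<close> positive.\<close>
  define \<delta> where "\<delta> = min (\<epsilon> / 2) (1 / 2)"
  have \<delta>: "0 < \<delta>" "\<delta> \<le> \<epsilon> / 2" "\<delta> \<le> 1/2" using \<open>\<epsilon> > 0\<close> by (auto simp: \<delta>_def)
  \<comment> \<open>Multiplied by \<open>n\<close>, the bound obtained here says that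
    n^(1-\<open>\<delta>\<close>) + 1 is at most \<open>\<delta>\<close> n, so rounding up still
    leaves \<open>t\<close> below \<open>\<delta>\<close> n.\<close>
  have "((\<lambda>n. real n powr (- \<delta>) + 1 / real n) \<longlongrightarrow> 0 + 0) sequentially"
    using \<delta> by (intro tendsto_add tendsto_neg_powr filterlim_real_sequentially lim_1_over_n) auto
  then have "\<forall>\<^sub>F n in sequentially. real n powr (- \<delta>) + 1 / real n < \<delta>"
    using \<delta>(1) by (intro order_tendstoD(2)[of _ "0"]) auto
  moreover have "\<forall>\<^sub>F n in sequentially. (1::nat) \<le> n" by (rule eventually_ge_at_top)
  ultimately show "\<forall>\<^sub>F n in sequentially. real (speed Fs n) \<ge> real n powr ((1 - \<epsilon>) * real n)"
  proof eventually_elim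
    case (elim n)
    define t where "t = nat \<lceil>real n powr (1 - \<delta>)\<rceil>"
    have n: "real n \<ge> 1" using elim by simp
    have t0: "real t \<ge> real n powr (1 - \<delta>)" unfolding t_def by linarith
    have one: "real n powr (1 - \<delta>) \<ge> 1" using n \<delta> by (intro ge_one_powr_ge_zero) auto
    have "real t < real n powr (1 - \<delta>) + 1" unfolding t_def using one by linarith
    also have "\<dots> = real n * (real n powr (- \<delta>) + 1 / real n)"
      using n by (simp add: distrib_left powr_diff powr_minus field_simps)
    also have "\<dots> \<le> real n * \<delta>" using elim n by (intro mult_left_mono) auto
    finally have t1: "real t \<le> \<delta> * real n" by (simp add: mult.commute)
    also have "\<dots> \<le> real n" using \<delta> n by (simp add: mult_left_le_one_le)
    finally have tn: "t \<le> n" by simp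
    have tpos: "0 < t" using t0 one by linarith
    have "real n powr ((1 - \<epsilon>) * real n) \<le> real n powr ((1 - \<delta>) * ((1 - \<delta>) * real n))"
    proof (rule powr_mono[OF _ n])
      have "(1 - \<epsilon>) * real n \<le> (1 - 2 * \<delta>) * real n" using \<delta> n by (intro mult_right_mono) auto
      also have "\<dots> \<le> ((1 - \<delta>) * (1 - \<delta>)) * real n"
        using n by (intro mult_right_mono) (auto simp: algebra_simps)
      finally show "(1 - \<epsilon>) * real n \<le> (1 - \<delta>) * ((1 - \<delta>) * real n)" by (simp add: mult.assoc)
    qed
    also have "\<dots> = (real n powr (1 - \<delta>)) powr ((1 - \<delta>) * real n)" by (simp add: powr_powr)
    also have "\<dots> \<le> real t powr ((1 - \<delta>) * real n)"
      using t0 one \<delta> n by (intro powr_mono2) auto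
    also have "\<dots> \<le> real t powr (real (n - t))"
      using t1 tn tpos by (intro powr_mono) (auto simp: algebra_simps of_nat_diff)
    also have "\<dots> = real (t ^ (n - t))" using tpos by (simp add: powr_realpow)
    also have "\<dots> \<le> real (speed Fs n)"
      using speed_ge_of_k_infinite[OF assms tpos tn] by linarith
    finally show ?case .
  qed
qed

section \<open>Word graphs and strips\<close>

lemma doubleton_in_word_graph_iff:
  "{x, y} \<in> snd (word_graph v HE U) \<longleftrightarrow> x \<in> U \<and> y \<in> U \<and> x \<noteq> y \<and>
     ((dist1 x y \<and> {v x, v y} \<notin> HE) \<or> (\<not> dist1 x y \<and> {v x, v y} \<in> HE))"
  unfolding word_graph_def snd_conv
  by (rule doubleton_in_edges_iff) (auto simp: dist1_commute insert_commute)

lemma fst_word_graph [simp]: "fst (word_graph v HE U) = U"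
  by (simp add: word_graph_def)

text \<open>Merges both cases of \<open>strip_adj\<close>: a pair of distinct vertices follows
  \<open>HE\<close>, reversed exactly on path steps inside one copy.\<close>

lemma doubleton_in_strip_iff:
  "{(a, j), (b, k)} \<in> snd (strip l HE m) \<longleftrightarrow> a \<in> {1..l} \<and> j \<in> {1..m} \<and> b \<in> {1..l} \<and> k \<in> {1..m} \<and>
     (a, j) \<noteq> (b, k) \<and> ({a, b} \<in> HE \<longleftrightarrow> \<not> (dist1 a b \<and> j = k))"
proof -
  have "{(a, j), (b, k)} \<in> snd (strip l HE m) \<longleftrightarrow> (a, j) \<in> {1..l} \<times> {1..m} \<and>
      (b, k) \<in> {1..l} \<times> {1..m} \<and> (a, j) \<noteq> (b, k) \<and> strip_adj HE (a, j) (b, k)"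
    unfolding strip_def snd_conv
    by (rule doubleton_in_edges_iff) (auto simp: strip_adj_def dist1_commute insert_commute)
  then show ?thesis by (auto simp: strip_adj_def)
qed

lemma fst_strip [simp]: "fst (strip l HE m) = {1..l} \<times> {1..m}"
  by (simp add: strip_def)

lemma card_le_max_order: "F \<in> set Fs \<Longrightarrow> card (fst F) \<le> max_order Fs"
  unfolding max_order_def by (induction Fs) auto

lemma finite_vertices_if_simple_graph: "simple_graph V E \<Longrightarrow> finite V"
  by (simp add: simple_graph_def)

text \<open>Transfers an embedding to another host by a map given only on the vertices
  \<open>S\<close> actually used. Their number is the order of \<open>F\<close>, which keeps the
  later constructions bounded.\<close>

lemma induced_sub_restrict_image:
  assumes "induced_sub F G" "finite (fst F)"
  obtains S where "S \<subseteq> fst G" "finite S" "card S = card (fst F)"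
    "\<And>H h. inj_on h S \<Longrightarrow> h ` S \<subseteq> fst H \<Longrightarrow>
      (\<And>x y. x \<in> S \<Longrightarrow> y \<in> S \<Longrightarrow> {x, y} \<in> snd G \<longleftrightarrow> {h x, h y} \<in> snd H) \<Longrightarrow> induced_sub F H"
proof -
  from assms(1) obtain f where f: "inj_on f (fst F)" "f ` fst F \<subseteq> fst G"
    "\<forall>x\<in>fst F. \<forall>y\<in>fst F. {x, y} \<in> snd F \<longleftrightarrow> {f x, f y} \<in> snd G"
    unfolding induced_sub_def by blast
  show thesis
  proof (rule that[of "f ` fst F"])
    show "f ` fst F \<subseteq> fst G" "finite (f ` fst F)" "card (f ` fst F) = card (fst F)"
      using f assms by (auto simp: card_image)
    fix h and H :: "'c set \<times> 'c set set"
    assume h: "inj_on h (f ` fst F)" "h ` f ` fst F \<subseteq> fst H"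
      "\<And>x y. x \<in> f ` fst F \<Longrightarrow> y \<in> f ` fst F \<Longrightarrow> {x, y} \<in> snd G \<longleftrightarrow> {h x, h y} \<in> snd H"
    have "inj_on (h \<circ> f) (fst F)" using f(1) h(1) by (rule comp_inj_on)
    with h f(3) show "induced_sub F H"
      unfolding induced_sub_def by (intro exI[of _ "h \<circ> f"]) (auto simp: image_comp)
  qed
qed

text \<open>Gaps longer than one period are shortened by multiples of the period \<open>l\<close>.\<close>
lemma compress_gaps:
  assumes "finite S" "0 \<notin> S" "0 < (l::nat)"
  shows "\<exists>g. strict_mono_on S g \<and> g ` S \<subseteq> {1..2 * l * card S} \<and>
    (\<forall>x\<in>S. g x mod l = x mod l) \<and> (\<forall>x\<in>S. \<forall>y\<in>S. dist1 (g x) (g y) \<longleftrightarrow> dist1 x y)"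
  using assms
proof (induction S rule: finite_linorder_max_induct)
  case empty
  then show ?case by (auto simp: strict_mono_on_def)
next
  case (insert x S)
  then obtain g where g: "strict_mono_on S g" "g ` S \<subseteq> {1..2 * l * card S}"
    "\<forall>x\<in>S. g x mod l = x mod l" "\<forall>x\<in>S. \<forall>y\<in>S. dist1 (g x) (g y) \<longleftrightarrow> dist1 x y" by auto
  have xS: "x \<notin> S" using insert.hyps by blast
  have card: "card (insert x S) = Suc (card S)" using insert.hyps xS by simp
  define B where "B = 2 * l * card S"
  have B': "2 * l * card (insert x S) = B + 2 * l" by (simp add: card B_def)
  have gB: "1 \<le> g y" "g y \<le> B" if "y \<in> S" for y using g(2) that by (auto simp: B_def)
  \<comment> \<open>A multiple of \<open>l\<close> that is at least \<open>B + 2\<close>, so adding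
    \<open>q - (B + 2)\<close> acts as subtracting \<open>B + 2\<close> modulo \<open>l\<close>
    without truncation. In the second case \<open>r\<close> is thus the first number from
    \<open>B + 2\<close> on that is congruent to \<open>x\<close>; starting at \<open>B + 2\<close>
    instead of \<open>B + 1\<close> avoids a false adjacency.\<close>
  define q where "q = l * (B + 2)"
  define r where "r = (if x - 1 \<in> S then g (x - 1) + 1
     else B + 2 + (x + (q - (B + 2))) mod l)"
  \<comment> \<open>A new run costs at most \<open>2 + (l - 1)\<close>, which is at most
    \<open>2 * l\<close> as \<open>l\<close> is positive.\<close>
  have r1: "r \<le> B + 2 * l"
  proof (cases "x - 1 \<in> S")
    case True
    then show ?thesis using gB[of "x - 1"] insert.prems by (simp add: r_def)
  next
    case False
    have "(x + (q - (B + 2))) mod l < l" using insert.prems by simp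
    then show ?thesis using False by (simp add: r_def)
  qed
  have r2: "r mod l = x mod l"
  proof (cases "x - 1 \<in> S")
    case True
    then have "g (x - 1) mod l = (x - 1) mod l" using g by blast
    then have "(g (x - 1) + 1) mod l = (x - 1 + 1) mod l" by (rule mod_add_cong) simp
    moreover have "x - 1 + 1 = x" using insert.prems by (cases x) auto
    ultimately show ?thesis using True by (simp add: r_def)
  next
    case False
    have "1 * (B + 2) \<le> q" unfolding q_def using insert.prems by (intro mult_right_mono) auto
    then have "B + 2 + (q - (B + 2)) = q" by simp
    then have "B + 2 + (x + (q - (B + 2))) = x + q" by linarith
    moreover have "r mod l = (B + 2 + (x + (q - (B + 2)))) mod l"
      unfolding r_def using False by (simp only: if_False mod_add_right_eq)
    ultimately have "r mod l = (x + q) mod l" by (simp only:)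
    then show ?thesis unfolding q_def by (simp only: mod_mult_self2)
  qed
  have r3: "g y < r" if "y \<in> S" for y
  proof (cases "x - 1 \<in> S")
    case True
    have "y \<le> x - 1" using insert.hyps that by fastforce
    then have "g y \<le> g (x - 1)"
      using g(1) True that by (metis le_eq_less_or_eq order_refl strict_mono_onD)
    then show ?thesis using True by (simp add: r_def)
  next
    case False
    then show ?thesis using gB[OF that] by (simp add: r_def)
  qed
  have r4: "dist1 (g y) r \<longleftrightarrow> dist1 y x" if "y \<in> S" for y
  proof -
    have yx: "y < x" using insert.hyps that by blast
    have "r = g y + 1 \<longleftrightarrow> x = y + 1"
    proof (cases "x - 1 \<in> S")
      case True
      have "g y = g (x - 1) \<longleftrightarrow> y = x - 1"
        using g(1) True that by (metis strict_mono_on_eqD)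
      then show ?thesis using True yx by (auto simp: r_def)
    next
      case False
      then have "x \<noteq> y + 1" using that by auto
      then show ?thesis using gB[OF that] False by (auto simp: r_def)
    qed
    then show ?thesis using r3[OF that] yx by (auto simp: dist1_def)
  qed
  have ne: "y \<noteq> x" "x \<noteq> y" if "y \<in> S" for y using xS that by auto
  show ?case
  proof (intro exI[of _ "g(x := r)"] conjI)
    show "strict_mono_on (insert x S) (g(x := r))"
      using g(1) r3 insert.hyps by (fastforce simp: strict_mono_on_def)
    show "(g(x := r)) ` insert x S \<subseteq> {1..2 * l * card (insert x S)}"
    proof -
      have "1 \<le> r" by (auto simp: r_def)
      then show ?thesis using r1 gB xS unfolding B' by fastforce
    qed
    show "\<forall>y\<in>insert x S. (g(x := r)) y mod l = y mod l" using g(3) r2 by simp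
    show "\<forall>y\<in>insert x S. \<forall>z\<in>insert x S. dist1 ((g(x := r)) y) ((g(x := r)) z) \<longleftrightarrow> dist1 y z"
    proof -
      have "dist1 r (g y) \<longleftrightarrow> dist1 x y" if "y \<in> S" for y
        using r4[OF that] dist1_commute by blast
      moreover have "\<not> dist1 r r" "\<not> dist1 x x" by (auto simp: dist1_def)
      ultimately show ?thesis using g(4) r4 ne by simp
    qed
  qed
qed

text \<open>Positivity matters: by truncated subtraction position 0 carries the letter of position
  1, not that of position \<open>length w\<close>.\<close>

lemma word_inf_mod_cong:
  assumes "x mod length w = y mod length w" "0 < x" "0 < y"
  shows "word_inf w x = word_inf w y"
proof -
  have "(x - 1) mod length w = (y - 1) mod length w"
  proof (cases "length w = 0")
    case True
    then show ?thesis using assms by simp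
  next
    case False
    have shift: "(z - 1) mod length w = (z + (length w - 1)) mod length w" if "0 < z" for z
    proof -
      have "z + (length w - 1) = z - 1 + length w" using that False by (cases "length w") auto
      then show ?thesis by simp
    qed
    have "(x + (length w - 1)) mod length w = (y + (length w - 1)) mod length w"
      using assms(1) by (rule mod_add_cong) simp
    then show ?thesis using shift[OF assms(2)] shift[OF assms(3)] by simp
  qed
  then show ?thesis by (simp add: word_inf_def)
qed

text \<open>The finite test of step (3b) suffices: compressing gaps keeps residues modulo
  \<open>l\<close>, hence letters, and keeps consecutiveness, and adjacency in a word graph depends
  on nothing else.\<close>

lemma free_of_word_graph:
  assumes Fs: "\<forall>F\<in>set Fs. simple_graph (fst F) (snd F)"
    and w: "length w = l" "0 < l"
    and free: "free_of Fs (word_graph (word_inf w) HE {1..2 * l * max_order Fs})"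
    and U: "0 \<notin> U"
  shows "free_of Fs (word_graph (word_inf w) HE U)"
  unfolding free_of_def
proof (intro ballI notI)
  fix F assume F: "F \<in> set Fs" and ind: "induced_sub F (word_graph (word_inf w) HE U)"
  have "finite (fst F)" using Fs F finite_vertices_if_simple_graph by blast
  then obtain S where S: "S \<subseteq> U" "finite S" "card S = card (fst F)"
    and emb: "\<And>(H :: nat set \<times> nat set set) h. inj_on h S \<Longrightarrow> h ` S \<subseteq> fst H \<Longrightarrow>
      (\<And>x y. x \<in> S \<Longrightarrow> y \<in> S \<Longrightarrow> {x, y} \<in> snd (word_graph (word_inf w) HE U) \<longleftrightarrow> {h x, h y} \<in> snd H)
      \<Longrightarrow> induced_sub F H"
    using induced_sub_restrict_image[OF ind] by (metis fst_word_graph)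
  have S0: "0 \<notin> S" using S U by blast
  obtain g where g: "strict_mono_on S g" "g ` S \<subseteq> {1..2 * l * card S}"
    "\<forall>x\<in>S. g x mod l = x mod l" "\<forall>x\<in>S. \<forall>y\<in>S. dist1 (g x) (g y) \<longleftrightarrow> dist1 x y"
    using compress_gaps[OF S(2) S0 w(2)] by blast
  have inj: "inj_on g S" using g(1) by (rule strict_mono_on_imp_inj_on)
  have "2 * l * card S \<le> 2 * l * max_order Fs" using card_le_max_order[OF F] S(3) by simp
  then have img: "g ` S \<subseteq> {1..2 * l * max_order Fs}"
    using g(2) by (meson atLeastatMost_subset_iff order_refl order_trans)
  have word: "word_inf w (g x) = word_inf w x" if "x \<in> S" for x
  proof (rule word_inf_mod_cong)
    show "0 < x" using that S0 by (cases x) auto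
    show "0 < g x" using that g(2) by (metis atLeastAtMost_iff image_subset_iff less_le_trans zero_less_one)
  qed (use that g(3) w in simp)
  have "induced_sub F (word_graph (word_inf w) HE {1..2 * l * max_order Fs})"
  proof (rule emb[OF inj])
    fix x y assume xy: "x \<in> S" "y \<in> S"
    then have "g x = g y \<longleftrightarrow> x = y" by (rule inj_on_eq_iff[OF inj])
    then show "{x, y} \<in> snd (word_graph (word_inf w) HE U) \<longleftrightarrow>
        {g x, g y} \<in> snd (word_graph (word_inf w) HE {1..2 * l * max_order Fs})"
      unfolding doubleton_in_word_graph_iff using xy img S(1) word[OF xy(1)] word[OF xy(2)] g(4)
      by (simp add: image_subset_iff subset_iff)
  qed (use img in simp)
  then show False using free F by (auto simp: free_of_def)
qed

section \<open>Speed of the class of a periodic word\<close>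

text \<open>The quotient n^n / n! is a single term of the exponential series at
  \<open>n\<close>.\<close>

lemma fact_ge_power_div_exp: "(real n / exp 1) ^ n \<le> fact n"
proof -
  have sums: "(\<lambda>k. real n ^ k /\<^sub>R fact k) sums exp (real n)" by (rule exp_converges)
  have "real n ^ n /\<^sub>R fact n = (\<Sum>k\<in>{n}. real n ^ k /\<^sub>R fact k)" by simp
  also have "\<dots> \<le> (\<Sum>k. real n ^ k /\<^sub>R fact k)"
    using sums by (intro sum_le_suminf) (auto simp: sums_iff)
  also have "\<dots> = exp 1 ^ n" using sums by (simp add: sums_iff flip: exp_of_nat_mult)
  finally show ?thesis by (simp add: field_simps power_divide)
qed

text \<open>A constant \<open>C\<close> per vertex is harmless because n^\<open>\<epsilon>\<close>
  eventually exceeds it.\<close>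

lemma above_Bell_if_power_le_speed:
  assumes C: "0 < C" and speed: "\<And>n. 0 < n \<Longrightarrow> (real n / C) ^ n \<le> real (speed Fs n)"
  shows "above_Bell Fs"
  unfolding above_Bell_def
proof (intro allI impI)
  fix \<epsilon> :: real assume "\<epsilon> > 0"
  have "((\<lambda>n. real n powr (- \<epsilon>)) \<longlongrightarrow> 0) sequentially"
    using \<open>\<epsilon> > 0\<close> by (intro tendsto_neg_powr filterlim_real_sequentially) auto
  then have "\<forall>\<^sub>F n in sequentially. real n powr (- \<epsilon>) < 1 / C"
    using C by (intro order_tendstoD(2)[of _ "0"]) auto
  moreover have "\<forall>\<^sub>F n in sequentially. (1::nat) \<le> n" by (rule eventually_ge_at_top)
  ultimately show "\<forall>\<^sub>F n in sequentially. real (speed Fs n) \<ge> real n powr ((1 - \<epsilon>) * real n)"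
  proof eventually_elim
    case (elim n)
    then have n: "real n \<ge> 1" by simp
    have "real n powr ((1 - \<epsilon>) * real n) = (real n powr (1 - \<epsilon>)) powr real n"
      by (simp add: powr_powr)
    also have "\<dots> = (real n powr (1 - \<epsilon>)) ^ n" using n by (intro powr_realpow) auto
    also have "real n powr (1 - \<epsilon>) = real n * real n powr (- \<epsilon>)"
      using n by (simp add: powr_diff powr_minus field_simps)
    also have "(real n * real n powr (- \<epsilon>)) ^ n \<le> (real n * (1 / C)) ^ n"
      using elim n by (intro power_mono mult_left_mono) auto
    also have "\<dots> \<le> real (speed Fs n)" using speed[of n] elim by simp
    finally show ?case .
  qed
qed

text \<open>The pairs whose adjacency disagrees with \<open>HE\<close> are exactly the edges of the path, so the
  labelled graph, its colouring by letters and the first vertex of the path determine the order of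
  the vertices.\<close>
lemma fact_le_speed_if_free_of_word_graph:
  assumes free: "free_of Fs (word_graph v HE {1..n})"
    and A: "finite A" "v ` {1..n} \<subseteq> A" and n: "0 < n"
  shows "fact n \<le> speed Fs n * card A ^ n * n"
proof -
  define E where "E = snd (word_graph v HE {1..n})"
  \<comment> \<open>\<open>p i\<close> is the label placed at position \<open>i\<close>, so edges
    and letters of a label are read off through \<open>inv p\<close>.\<close>
  define code where
    "code p = (pull (inv p) {1..n} E, restrict (v \<circ> inv p) {1..n}, p 1)" for p
  let ?P = "{p. p permutes {1..n}}"
  let ?C = "{E. in_Free Fs {1..n} E} \<times> ({1..n} \<rightarrow>\<^sub>E A) \<times> {1..n}"
  have E_iff: "{i, j} \<in> E \<longleftrightarrow> (dist1 i j \<longleftrightarrow> {v i, v j} \<notin> HE)"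
    if "i \<in> {1..n}" "j \<in> {1..n}" "i \<noteq> j" for i j
    using that unfolding E_def doubleton_in_word_graph_iff by blast
  have loopless: "{x} \<notin> E" for x
    using doubleton_in_word_graph_iff[of x x v HE "{1..n}"] by (simp add: E_def)
  have pull_iff: "{p i, p j} \<in> pull (inv p) {1..n} E \<longleftrightarrow> i \<noteq> j \<and> {i, j} \<in> E"
    if p: "p permutes {1..n}" and "i \<in> {1..n}" "j \<in> {1..n}" for p i j
    using that permutes_in_image[OF p] permutes_inverses[OF p] permutes_inj[OF p]
    by (simp add: doubleton_in_pull_iff inj_eq)
  have "inj_on code ?P"
  proof (rule inj_onI)
    fix p q assume "p \<in> ?P" "q \<in> ?P" and eq: "code p = code q"
    then have p: "p permutes {1..n}" and q: "q permutes {1..n}" by auto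
    have eqE: "pull (inv p) {1..n} E = pull (inv q) {1..n} E" and start: "p 1 = q 1"
      and res: "restrict (v \<circ> inv p) {1..n} = restrict (v \<circ> inv q) {1..n}"
      using eq by (simp_all add: code_def)
    have eqv: "v (inv p x) = v (inv q x)" if "x \<in> {1..n}" for x
      using fun_cong[OF res, of x] that by simp
    have "p i = q i" if "1 \<le> i" "i \<le> n" for i
      using that
    proof (induction i rule: less_induct)
      case (less i)
      show ?case
      proof (cases "i = 1")
        case True
        then show ?thesis using start by simp
      next
        case False
        define h where "h = i - 1"
        have h: "i = Suc h" "h \<in> {1..n}" "i \<in> {1..n}" using False less.prems by (auto simp: h_def)
        \<comment> \<open>The position at which \<open>p\<close> places the label that
          \<open>q\<close> places at \<open>i\<close>. Positions below \<open>i\<close> are already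
          matched, so \<open>j\<close> is not smaller than \<open>i\<close>.\<close>
        define j where "j = inv p (q i)"
        have pj: "p j = q i" unfolding j_def using permutes_inverses[OF p] by simp
        have qi: "q i \<in> {1..n}" using permutes_in_image[OF q] h by blast
        then have j: "j \<in> {1..n}" using permutes_in_image[OF p] pj by metis
        have ji: "\<not> j < i"
        proof
          assume "j < i"
          then have "p j = q j" using less.IH j by auto
          then have "q i = q j" using pj by simp
          then show False using permutes_inj[OF q] \<open>j < i\<close> by (auto simp: inj_eq)
        qed
        have vj: "v j = v i"
          using eqv[OF qi] permutes_inverses[OF q] by (simp add: j_def)
        have ph: "p h = q h" using less.IH h by auto
        have "{h, j} \<in> E \<longleftrightarrow> {p h, p j} \<in> pull (inv p) {1..n} E"
          using pull_iff[OF p h(2) j] h ji by auto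
        also have "\<dots> \<longleftrightarrow> {q h, q i} \<in> pull (inv q) {1..n} E" using eqE ph pj by simp
        also have "\<dots> \<longleftrightarrow> {h, i} \<in> E" using pull_iff[OF q h(2) h(3)] h by auto
        finally have "dist1 h j \<longleftrightarrow> dist1 h i"
          using E_iff[OF h(2) j] E_iff[OF h(2) h(3)] vj h ji by auto
        \<comment> \<open>With equal letters at \<open>j\<close> and \<open>i\<close>, equal
          adjacency to \<open>h\<close> forces equal consecutiveness, and the only neighbour of
          \<open>h\<close> on the path that is not below \<open>i\<close> is
          \<open>i\<close>.\<close>
        then have "j = i" using h ji by (auto simp: dist1_def)
        then show ?thesis using pj by simp
      qed
    qed
    then have "p x = q x" for x
      using permutes_not_in[OF p, of x] permutes_not_in[OF q, of x] by (cases "x \<in> {1..n}") auto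
    then show "p = q" by blast
  qed
  moreover have "code ` ?P \<subseteq> ?C"
  proof (intro image_subsetI)
    fix p assume "p \<in> ?P"
    then have p: "p permutes {1..n}" by simp
    have ip: "inv p permutes {1..n}" using p by (rule permutes_inv)
    have "free_of Fs ({1..n}, E)" using free by (simp add: E_def word_graph_def)
    then have "in_Free Fs {1..n} (pull (inv p) {1..n} E)"
      using permutes_inj_on[OF ip] permutes_image[OF ip] loopless by (intro in_Free_pull) auto
    moreover have "inv p x \<in> {1..n}" if "x \<in> {1..n}" for x using permutes_in_image[OF ip] that by blast
    then have "restrict (v \<circ> inv p) {1..n} \<in> {1..n} \<rightarrow>\<^sub>E A" using A by auto
    moreover have "p 1 \<in> {1..n}" using permutes_in_image[OF p, of 1] n by simp
    ultimately show "code p \<in> ?C" by (simp add: code_def)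
  qed
  moreover have "finite ?C" using finite_in_Free A by (auto intro!: finite_PiE)
  ultimately have "card ?P \<le> card ?C" by (rule card_inj_on_le)
  moreover have "card ?P = fact n" by (simp add: card_permutations)
  moreover have "card ?C = speed Fs n * card A ^ n * n"
    by (simp add: card_cartesian_product card_PiE speed_def)
  ultimately show ?thesis by simp
qed

lemma above_Bell_if_stop_yes:
  assumes Fs: "\<forall>F\<in>set Fs. simple_graph (fst F) (snd F)" and l: "1 \<le> l" and yes: "stop_yes Fs l"
  shows "above_Bell Fs"
proof -
  from yes obtain HE w where w: "length w = l" "set w \<subseteq> {1..l}"
    and free: "free_of Fs (word_graph (word_inf w) HE {1..2 * l * max_order Fs})"
    unfolding stop_yes_def free_of_def by blast
  have "word_inf w x \<in> set w" for x
    unfolding word_inf_def using w l by (intro nth_mem) simp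
  then have "word_inf w ` {1..n} \<subseteq> {1..l}" for n
    using w(2) by blast
  moreover have "free_of Fs (word_graph (word_inf w) HE {1..n})" for n
    using free_of_word_graph[OF Fs w(1) _ free] l by simp
  ultimately have count: "fact n \<le> speed Fs n * l ^ n * n" if "0 < n" for n
    using fact_le_speed_if_free_of_word_graph[of Fs "word_inf w" HE n "{1..l}"] that by simp
  show ?thesis
  proof (rule above_Bell_if_power_le_speed)
    \<comment> \<open>The factors of the constant: 2 absorbs the start vertex through
      \<open>n < 2 ^ n\<close>, e comes from the factorial, \<open>l\<close> from the colourings by
      letters.\<close>
    show "0 < 2 * exp 1 * real l" using l by simp
    fix n :: nat assume n: "0 < n"
    have "(real n / exp 1) ^ n \<le> fact n" by (rule fact_ge_power_div_exp)
    also have "\<dots> \<le> real (speed Fs n * l ^ n * n)"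
      using count[OF n] by (metis of_nat_fact of_nat_le_iff)
    also have "\<dots> \<le> real (speed Fs n * l ^ n * 2 ^ n)"
      by (intro of_nat_mono mult_left_mono) (auto intro: less_imp_le)
    also have "\<dots> = real (speed Fs n) * (2 * real l) ^ n" by (simp add: power_mult_distrib)
    finally show "(real n / (2 * exp 1 * real l)) ^ n \<le> real (speed Fs n)"
      using l by (simp add: power_divide power_mult_distrib field_simps)
  qed
qed

section \<open>Long strips contain periodic words\<close>

text \<open>Consecutive runs of \<open>S\<close> are sent to different copies, and each of them to consecutive
  positions.\<close>
lemma spread_runs:
  assumes "finite S" "0 \<notin> S" "0 < (l::nat)"
  shows "\<exists>pos copy. (\<forall>x\<in>S. pos x mod l = (x - 1) mod l \<and> pos x < l + card S \<and>
      copy x \<in> {1..card S}) \<and>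
    (\<forall>x\<in>S. \<forall>y\<in>S. x < y \<longrightarrow> copy x < copy y \<or> copy x = copy y \<and> pos x < pos y) \<and>
    (\<forall>x\<in>S. \<forall>y\<in>S. dist1 (pos x) (pos y) \<and> copy x = copy y \<longleftrightarrow> dist1 x y)"
  using assms
proof (induction S rule: finite_linorder_max_induct)
  case empty
  then show ?case by auto
next
  case (insert x S)
  then obtain pos copy where IH1: "\<forall>x\<in>S. pos x mod l = (x - 1) mod l \<and> pos x < l + card S \<and>
      copy x \<in> {1..card S}"
    and IH2: "\<forall>x\<in>S. \<forall>y\<in>S. x < y \<longrightarrow> copy x < copy y \<or> copy x = copy y \<and> pos x < pos y"
    and IH3: "\<forall>x\<in>S. \<forall>y\<in>S. dist1 (pos x) (pos y) \<and> copy x = copy y \<longleftrightarrow> dist1 x y"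
    by auto
  have xS: "x \<notin> S" and x0: "0 < x" using insert.hyps insert.prems by auto
  have card: "card (insert x S) = Suc (card S)" using insert.hyps xS by simp
  \<comment> \<open>A run starts at a position below \<open>l\<close> in a fresh copy and grows by
    one per vertex, which gives \<open>l + card S\<close> as bound. Positions count from 0, whence
    \<open>x - 1\<close>.\<close>
  define P where "P = (if x - 1 \<in> S then pos (x - 1) + 1 else (x - 1) mod l)"
  define C where "C = (if x - 1 \<in> S then copy (x - 1) else Suc (card S))"
  have PC: "P mod l = (x - 1) mod l \<and> P < l + Suc (card S) \<and> C \<in> {1..Suc (card S)}"
  proof (cases "x - 1 \<in> S")
    case True
    then have IH: "pos (x - 1) mod l = (x - 1 - 1) mod l" "pos (x - 1) < l + card S"
      "copy (x - 1) \<in> {1..card S}" using IH1 by auto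
    have "x - 1 - 1 + 1 = x - 1" using True insert.prems by (cases "x - 1") auto
    moreover have "(pos (x - 1) + 1) mod l = (x - 1 - 1 + 1) mod l"
      using IH(1) by (rule mod_add_cong) simp
    ultimately show ?thesis using True IH by (simp add: P_def C_def)
  next
    case False
    have "(x - 1) mod l < l" using insert.prems by simp
    then show ?thesis using False by (simp add: P_def C_def)
  qed
  \<comment> \<open>The lexicographic order serves twice: it makes the placement injective, and it
    prevents non-consecutive vertices of one run from becoming adjacent.\<close>
  have lex: "copy y < C \<or> copy y = C \<and> pos y < P" if "y \<in> S" for y
  proof (cases "x - 1 \<in> S")
    case True
    have "y < x - 1 \<or> y = x - 1" using insert.hyps that by fastforce
    then show ?thesis using IH2 True that by (fastforce simp: P_def C_def)
  next
    case False
    have "copy y \<le> card S" using IH1 that by auto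
    then show ?thesis using False by (simp add: C_def)
  qed
  have adj: "dist1 (pos y) P \<and> copy y = C \<longleftrightarrow> dist1 y x" if "y \<in> S" for y
  proof (cases "x - 1 \<in> S")
    case True
    have "y < x - 1 \<or> y = x - 1" using insert.hyps that by fastforce
    then show ?thesis
    proof
      assume "y = x - 1"
      then show ?thesis using True x0 by (simp add: P_def C_def dist1_def)
    next
      assume "y < x - 1"
      moreover from this have "copy y < copy (x - 1) \<or> copy y = copy (x - 1) \<and> pos y < pos (x - 1)"
        using IH2 True that by blast
      ultimately show ?thesis using True by (auto simp: P_def C_def dist1_def)
    qed
  next
    case False
    have "copy y \<le> card S" using IH1 that by auto
    moreover have "\<not> dist1 y x"
    proof
      assume "dist1 y x"
      moreover have "y < x" using insert.hyps that by blast
      ultimately have "y = x - 1" by (auto simp: dist1_def)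
      then show False using False that by simp
    qed
    ultimately show ?thesis using False by (simp add: C_def)
  qed
  have ne: "y \<noteq> x" "x \<noteq> y" if "y \<in> S" for y using xS that by auto
  show ?case
  proof (rule exI[of _ "pos(x := P)"], rule exI[of _ "copy(x := C)"], intro conjI)
    show "\<forall>y\<in>insert x S. (pos(x := P)) y mod l = (y - 1) mod l \<and>
        (pos(x := P)) y < l + card (insert x S) \<and> (copy(x := C)) y \<in> {1..card (insert x S)}"
      using PC IH1 ne unfolding card by (auto simp: less_Suc_eq)
    show "\<forall>y\<in>insert x S. \<forall>z\<in>insert x S. y < z \<longrightarrow> (copy(x := C)) y < (copy(x := C)) z \<or>
        (copy(x := C)) y = (copy(x := C)) z \<and> (pos(x := P)) y < (pos(x := P)) z"
    proof (intro ballI impI)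
      fix y z assume yz: "y \<in> insert x S" "z \<in> insert x S" "y < z"
      then have y: "y \<in> S" using insert.hyps(2) by (metis insertE less_asym less_irrefl)
      show "(copy(x := C)) y < (copy(x := C)) z \<or>
        (copy(x := C)) y = (copy(x := C)) z \<and> (pos(x := P)) y < (pos(x := P)) z"
      proof (cases "z = x")
        case True
        then show ?thesis using lex[OF y] ne[OF y] by simp
      next
        case False
        then have "z \<in> S" using yz by blast
        then show ?thesis using IH2 y yz(3) False ne[OF y] by simp
      qed
    qed
    show "\<forall>y\<in>insert x S. \<forall>z\<in>insert x S. dist1 ((pos(x := P)) y) ((pos(x := P)) z) \<and>
        (copy(x := C)) y = (copy(x := C)) z \<longleftrightarrow> dist1 y z"
    proof -
      have "dist1 P (pos y) \<and> C = copy y \<longleftrightarrow> dist1 x y" if "y \<in> S" for y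
        using adj[OF that] dist1_commute by metis
      moreover have "\<not> dist1 P P" "\<not> dist1 x x" by (auto simp: dist1_def)
      ultimately show ?thesis using IH3 adj ne by simp
    qed
  qed
qed

section \<open>Finite k: only boundedly many traces are shared by many vertices\<close>

definition trace :: "'a set set \<Rightarrow> 'a set \<Rightarrow> 'a \<Rightarrow> 'a set" where
  "trace E X u = {z\<in>X. {u, z} \<in> E}"

text \<open>The negation of \<open>k_infinite\<close> with indexed families replaced by sets of
  traces: the classes are taken as large as possible, so each is named by its trace on
  \<open>X\<close>.\<close>

definition trace_bound :: "(nat set \<times> nat set set) list \<Rightarrow> nat \<Rightarrow> nat \<Rightarrow> bool" where
  "trace_bound Fs m k \<longleftrightarrow> (\<forall>V E X \<T>. in_Free Fs V E \<longrightarrow> X \<subseteq> V \<longrightarrow> finite \<T> \<longrightarrow>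
     (\<forall>T\<in>\<T>. k \<le> card {u \<in> V - X. trace E X u = T}) \<longrightarrow> card \<T> < m)"

lemma trace_bound_if_not_k_infinite:
  assumes "\<not> k_infinite Fs"
  obtains m k where "trace_bound Fs m k"
proof -
  from assms[unfolded k_infinite_def not_all] obtain k m where neg: "\<not> (\<exists>V E X (U :: nat \<Rightarrow> nat set).
      in_Free Fs V E \<and> X \<subseteq> V \<and>
      (\<forall>i<m. U i \<subseteq> V - X \<and> card (U i) \<ge> k) \<and>
      (\<forall>i<m. \<forall>j<m. i \<noteq> j \<longrightarrow> U i \<inter> U j = {}) \<and>
      (\<forall>i<m. \<forall>x\<in>U i. \<forall>y\<in>U i. {z\<in>X. {x, z} \<in> E} = {z\<in>X. {y, z} \<in> E}) \<and>
      (\<forall>i<m. \<forall>j<m. i \<noteq> j \<longrightarrow> (\<forall>x\<in>U i. \<forall>y\<in>U j. {z\<in>X. {x, z} \<in> E} \<noteq> {z\<in>X. {y, z} \<in> E})))"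
    by (elim exE) (rule that)
  have "trace_bound Fs m k"
    unfolding trace_bound_def
  proof (intro allI impI, rule ccontr)
    fix V E X \<T>
    assume free: "in_Free Fs V E" and X: "X \<subseteq> V" and "\<not> card \<T> < m"
      and big: "\<forall>T\<in>\<T>. k \<le> card {u \<in> V - X. trace E X u = T}"
    then obtain \<T>' where \<T>': "\<T>' \<subseteq> \<T>" "card \<T>' = m" "finite \<T>'"
      using obtain_subset_with_card_n by (metis not_less)
    obtain e where e: "bij_betw e {0..<m} \<T>'" using ex_bij_betw_nat_finite[OF \<T>'(3)] \<T>'(2) by blast
    have e\<T>: "e i \<in> \<T>" if "i < m" for i using e that \<T>'(1) by (auto simp: bij_betw_def)
    have inj: "e i \<noteq> e j" if "i < m" "j < m" "i \<noteq> j" for i j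
      using inj_on_eq_iff[OF bij_betw_imp_inj_on[OF e], of i j] that by auto
    show False
      by (rule notE[OF neg], rule exI[of _ V], rule exI[of _ E], rule exI[of _ X],
          rule exI[of _ "\<lambda>i. {u \<in> V - X. trace E X u = e i}"])
        (use free X big e\<T> inj in \<open>auto simp: trace_def\<close>)
  qed
  then show thesis by (rule that)
qed

text \<open>Take the first copy of the strip as separating set. Between different copies nothing is
  reversed, so the \<open>L - 1\<close> vertices of row \<open>a\<close> in the other copies all
  have the row of \<open>a\<close> as trace.\<close>

lemma card_rows_less_if_free_of_strip:
  fixes HE :: "nat set set"
  assumes free: "free_of Fs (strip L HE L)" and k: "k < L"
    and bound: "trace_bound Fs m k"
  shows "card ((\<lambda>a. {c \<in> {1..L}. {a, c} \<in> HE}) ` {1..L}) < m"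
proof -
  define row where "row a = {c \<in> {1..L}. {a, c} \<in> HE}" for a
  define R where "R = row ` {1..L}"
  \<comment> \<open>\<open>in_Free\<close> speaks of graphs on natural numbers, so the pairs are
    encoded.\<close>
  define A where "A = prod_encode ` ({1..L} \<times> {1..L})"
  define E where "E = pull prod_decode A (snd (strip L HE L))"
  define X where "X = (\<lambda>c. prod_encode (c, 1)) ` {1..L}"
  define lift where "lift T = (\<lambda>c. prod_encode (c, 1)) ` T" for T :: "nat set"
  have "inj (\<lambda>c. prod_encode (c, 1 :: nat))" by (rule injI) (simp add: prod_encode_eq)
  then have inj_lift: "inj lift" unfolding lift_def by (intro injI) (simp only: inj_image_eq_iff)
  have loopless: "{z} \<notin> snd (strip L HE L)" for z
    using doubleton_in_strip_iff[of "fst z" "snd z" "fst z" "snd z"] by simp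
  have "in_Free Fs A E"
    unfolding E_def
  proof (rule in_Free_pull)
    show "free_of Fs ({1..L} \<times> {1..L}, snd (strip L HE L))"
      using free by (simp add: strip_def)
    show "inj_on prod_decode A" using inj_on_subset[OF inj_prod_decode[of UNIV]] by blast
  qed (use loopless in \<open>auto simp: A_def\<close>)
  moreover have "X \<subseteq> A" by (auto simp: X_def A_def)
  moreover have "finite (lift ` R)" by (simp add: R_def)
  moreover have "\<forall>T\<in>lift ` R. k \<le> card {u \<in> A - X. trace E X u = T}"
  proof
    fix T assume "T \<in> lift ` R"
    then obtain a where a: "a \<in> {1..L}" "T = lift (row a)" by (auto simp: R_def)
    have "trace E X (prod_encode (a, j)) = T" if j: "j \<in> {2..L}" for j
    proof -
      have "{prod_encode (a, j), prod_encode (c, 1)} \<in> E \<longleftrightarrow> {a, c} \<in> HE" if "c \<in> {1..L}" for c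
        using a j that by (simp add: E_def doubleton_in_pull_iff doubleton_in_strip_iff A_def)
      then show ?thesis by (auto simp: trace_def X_def a(2) lift_def row_def)
    qed
    then have "(\<lambda>j. prod_encode (a, j)) ` {2..L} \<subseteq> {u \<in> A - X. trace E X u = T}"
      using a by (auto simp: A_def X_def prod_encode_eq)
    moreover have "card ((\<lambda>j. prod_encode (a, j)) ` {2..L}) = L - 1"
      by (subst card_image) (auto simp: inj_on_def prod_encode_eq)
    moreover have "finite {u \<in> A - X. trace E X u = T}" by (simp add: A_def)
    ultimately have "L - 1 \<le> card {u \<in> A - X. trace E X u = T}" by (metis card_mono)
    then show "k \<le> card {u \<in> A - X. trace E X u = T}" using k by linarith
  qed
  ultimately have "card (lift ` R) < m" using bound unfolding trace_bound_def by metis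
  moreover have "card (lift ` R) = card R"
    using inj_on_subset[OF inj_lift] by (intro card_image) blast
  ultimately show ?thesis by (simp add: R_def row_def[abs_def])
qed

text \<open>Pigeonhole: there are at most \<open>r ^ m\<close> words of length \<open>m\<close> over
  \<open>R\<close>, and one more starting position than that.\<close>

lemma repeated_window:
  fixes row :: "nat \<Rightarrow> 'a"
  assumes "finite R" "card R \<le> r" "\<And>a. a \<in> {1..Suc (r ^ m) + m} \<Longrightarrow> row a \<in> R"
  obtains p q where "1 \<le> p" "p < q" "q \<le> Suc (r ^ m)" "\<And>i. i < m \<Longrightarrow> row (p + i) = row (q + i)"
proof -
  define word where "word p = map (\<lambda>i. row (p + i)) [0..<m]" for p
  have "word ` {1..Suc (r ^ m)} \<subseteq> {xs. set xs \<subseteq> R \<and> length xs = m}"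
    using assms(3) by (fastforce simp: word_def)
  then have "card (word ` {1..Suc (r ^ m)}) \<le> card {xs. set xs \<subseteq> R \<and> length xs = m}"
    using finite_lists_length_eq[OF assms(1)] by (intro card_mono) auto
  also have "\<dots> = card R ^ m" by (rule card_lists_length_eq[OF assms(1)])
  also have "\<dots> \<le> r ^ m" using assms(2) by (rule power_mono) simp
  also have "\<dots> < card {1..Suc (r ^ m)}" by simp
  finally have "\<not> inj_on word {1..Suc (r ^ m)}" by (rule pigeonhole)
  then obtain p q where pq: "p \<in> {1..Suc (r ^ m)}" "q \<in> {1..Suc (r ^ m)}" "p < q" "word p = word q"
    unfolding inj_on_def by (metis linorder_neqE_nat)
  then have "row (p + i) = row (q + i)" if "i < m" for i
    using that unfolding word_def by (simp add: map_eq_conv)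
  with pq show thesis using that by auto
qed

lemma stop_yes_if_never_stop_no:
  assumes Fs: "\<forall>F\<in>set Fs. simple_graph (fst F) (snd F)"
    and fin: "\<not> k_infinite Fs" and no: "\<And>l. 1 \<le> l \<Longrightarrow> \<not> stop_no Fs l"
  shows "\<exists>l\<ge>1. stop_yes Fs l"
proof -
  obtain r k where bound: "trace_bound Fs r k"
    using trace_bound_if_not_k_infinite[OF fin] by blast
  define m where "m = max_order Fs"
  \<comment> \<open>\<open>Suc (r ^ m)\<close> starting positions, \<open>m\<close> further rows for
    the last window, and \<open>k\<close> so that the row bound applies.\<close>
  define L where "L = Suc (r ^ m) + m + k"
  have "1 \<le> L" by (simp add: L_def)
  then obtain HE where free: "free_of Fs (strip L HE L)"
    using no[of L] unfolding stop_no_def free_of_def by blast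
  define row where "row a = {c \<in> {1..L}. {a, c} \<in> HE}" for a
  have "card (row ` {1..L}) < r"
    unfolding row_def[abs_def] using card_rows_less_if_free_of_strip[OF free _ bound] by (simp add: L_def)
  then have cr: "card (row ` {1..L}) \<le> r" by simp
  obtain p q where p: "1 \<le> p" and pq: "p < q" "q \<le> Suc (r ^ m)"
    and win: "\<And>i. i < m \<Longrightarrow> row (p + i) = row (q + i)"
    using repeated_window[OF _ cr, of m row] by (auto simp: L_def)
  define l where "l = q - p"
  have l: "0 < l" "q = p + l" using pq by (auto simp: l_def)
  \<comment> \<open>The equal windows extend the period by \<open>m\<close> rows beyond
    \<open>q\<close>, as far as a run of at most \<open>m\<close> vertices starting inside the
    period can reach.\<close>
  have per: "row (p + j) = row (p + j mod l)" if "j < l + m" for j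
    using that
  proof (induction j rule: less_induct)
    case (less j)
    show ?case
    proof (cases "j < l")
      case False
      then have "row (p + j) = row (p + (j - l))"
        using win[of "j - l"] less.prems l by simp
      also have "\<dots> = row (p + (j - l) mod l)" 
        using less.IH[of "j - l"] less.prems False l by linarith
      also have "(j - l) mod l = j mod l" using False by (simp add: le_mod_geq)
      finally show ?thesis .
    qed simp
  qed
  \<comment> \<open>Edges of \<open>HE\<close> are unordered, so equal rows may be exchanged at one
    end and then at the other.\<close>
  have HE_cong: "{a, b} \<in> HE \<longleftrightarrow> {a', b'} \<in> HE"
    if "row a = row a'" "row b = row b'" "{a, b, a', b'} \<subseteq> {1..L}" for a b a' b'
  proof -
    have row_iff: "c \<in> row d \<longleftrightarrow> {d, c} \<in> HE" if "c \<in> {1..L}" for c d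
      using that by (simp add: row_def)
    have in_L: "a' \<in> {1..L}" "b \<in> {1..L}" using that(3) by simp_all
    have "{a, b} \<in> HE \<longleftrightarrow> {a', b} \<in> HE" using row_iff[OF in_L(2)] that(1) by blast
    also have "\<dots> \<longleftrightarrow> {b, a'} \<in> HE" by (simp add: insert_commute)
    also have "\<dots> \<longleftrightarrow> {b', a'} \<in> HE" using row_iff[OF in_L(1)] that(2) by blast
    also have "\<dots> \<longleftrightarrow> {a', b'} \<in> HE" by (simp add: insert_commute)
    finally show ?thesis .
  qed
  \<comment> \<open>The rows \<open>p\<close> to \<open>q - 1\<close> renumbered as \<open>1\<close>
    to \<open>l\<close>; the word then simply lists the alphabet.\<close>
  define HE' where "HE' = {{a, b} | a b. a \<in> {1..l} \<and> b \<in> {1..l} \<and> {p + (a - 1), p + (b - 1)} \<in> HE}"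
  define w where "w = [1..<Suc l]"
  have HE'_iff: "{a, b} \<in> HE' \<longleftrightarrow> {p + (a - 1), p + (b - 1)} \<in> HE" if "a \<in> {1..l}" "b \<in> {1..l}" for a b
    using that unfolding HE'_def mem_Collect_eq doubleton_eq_iff by (metis insert_commute)
  have w: "word_inf w x = Suc ((x - 1) mod l)" for x
    using l by (simp add: word_inf_def w_def del: upt_Suc)
  have "free_of Fs (word_graph (word_inf w) HE' {1..2 * l * m})"
    unfolding free_of_def
  proof (intro ballI notI)
    fix F assume F: "F \<in> set Fs" and ind: "induced_sub F (word_graph (word_inf w) HE' {1..2 * l * m})"
    have "finite (fst F)" using Fs F finite_vertices_if_simple_graph by blast
    then obtain S where S: "S \<subseteq> {1..2 * l * m}" "finite S" "card S = card (fst F)"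
      and emb: "\<And>(H :: (nat \<times> nat) set \<times> (nat \<times> nat) set set) h. inj_on h S \<Longrightarrow> h ` S \<subseteq> fst H \<Longrightarrow>
        (\<And>x y. x \<in> S \<Longrightarrow> y \<in> S \<Longrightarrow> {x, y} \<in> snd (word_graph (word_inf w) HE' {1..2 * l * m})
           \<longleftrightarrow> {h x, h y} \<in> snd H) \<Longrightarrow> induced_sub F H"
      using induced_sub_restrict_image[OF ind] by (metis fst_word_graph)
    have Sm: "card S \<le> m" using card_le_max_order[OF F] S(3) by (simp add: m_def)
    have "0 \<notin> S" using S(1) by auto
    from spread_runs[OF S(2) this l(1)] obtain pos copy where
      pc: "\<forall>x\<in>S. pos x mod l = (x - 1) mod l \<and> pos x < l + card S \<and> copy x \<in> {1..card S}"
      and lex: "\<forall>x\<in>S. \<forall>y\<in>S. x < y \<longrightarrow> copy x < copy y \<or> copy x = copy y \<and> pos x < pos y"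
      and adj: "\<forall>x\<in>S. \<forall>y\<in>S. dist1 (pos x) (pos y) \<and> copy x = copy y \<longleftrightarrow> dist1 x y"
      by (elim exE conjE) (rule that)
    note pc = pc[rule_format] and lex = lex[rule_format] and adj = adj[rule_format]
    \<comment> \<open>Changing the copy between runs ensures that the strip reverses adjacency
      exactly where the word graph does.\<close>
    define h where "h x = (p + pos x, copy x)" for x
    have inj: "inj_on h S"
    proof (rule inj_onI, rule ccontr)
      fix x y assume xy: "x \<in> S" "y \<in> S" "h x = h y" "x \<noteq> y"
      then have "x < y \<or> y < x" by linarith
      then show False using lex[OF xy(1,2)] lex[OF xy(2,1)] xy(3) by (auto simp: h_def)
    qed
    have range: "p + pos x \<in> {1..L} \<and> p + (x - 1) mod l \<in> {1..L} \<and> copy x \<in> {1..L}" if "x \<in> S" for x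
    proof -
      have "(x - 1) mod l < l" using l by simp
      then have "p + (x - 1) mod l \<le> L" using pq l(2) unfolding L_def by linarith
      then show ?thesis using pc[OF that] Sm p pq l(2) by (auto simp: L_def)
    qed
    have "induced_sub F (strip L HE L)"
    proof (rule emb[OF inj])
      show "h ` S \<subseteq> fst (strip L HE L)" using range by (auto simp: h_def)
      fix x y assume x: "x \<in> S" and y: "y \<in> S"
      have row: "row (p + pos z) = row (p + (z - 1) mod l)" if "z \<in> S" for z
        using per[of "pos z"] pc[OF that] Sm by simp
      have lt: "(z - 1) mod l < l" for z using l by simp
      have "{word_inf w x, word_inf w y} \<in> HE' \<longleftrightarrow> {p + (x - 1) mod l, p + (y - 1) mod l} \<in> HE"
        using HE'_iff lt[of x] lt[of y] by (simp add: w Suc_le_eq)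
      also have "\<dots> \<longleftrightarrow> {p + pos x, p + pos y} \<in> HE"
        using range[OF x] range[OF y] row[OF x] row[OF y] by (intro HE_cong) auto
      finally have HE: "{word_inf w x, word_inf w y} \<in> HE' \<longleftrightarrow> {p + pos x, p + pos y} \<in> HE" .
      have d: "dist1 (p + a) (p + b) \<longleftrightarrow> dist1 a b" for a b by (auto simp: dist1_def)
      have "h x = h y \<longleftrightarrow> x = y" using inj_on_eq_iff[OF inj x y] .
      then have eq: "(p + pos x, copy x) = (p + pos y, copy y) \<longleftrightarrow> x = y" by (simp add: h_def)
      have "x \<in> {1..2 * l * m}" "y \<in> {1..2 * l * m}" using S(1) x y by auto
      then show "{x, y} \<in> snd (word_graph (word_inf w) HE' {1..2 * l * m})
          \<longleftrightarrow> {h x, h y} \<in> snd (strip L HE L)"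
        unfolding h_def doubleton_in_word_graph_iff doubleton_in_strip_iff eq d HE
        using range[OF x] range[OF y] adj[OF x y] by blast
    qed
    then show False using free F by (auto simp: free_of_def)
  qed
  moreover have "loop_graph l HE'" by (auto simp: loop_graph_def HE'_def)
  moreover have "length w = l" "distinct w" "set w \<subseteq> {1..l}" by (auto simp: w_def)
  ultimately have "stop_yes Fs l" unfolding stop_yes_def free_of_def m_def by blast
  then show ?thesis using l(1) by (intro exI[of _ l]) auto
qed

section \<open>Flips of bounded degree\<close>

definition trace_class :: "'a set \<Rightarrow> 'a set set \<Rightarrow> 'a set \<Rightarrow> 'a set \<Rightarrow> 'a set" where
  "trace_class V E X T = {u \<in> V - X. trace E X u = T}"

text \<open>One \<open>t\<close> bounds \<open>X\<close> and counts the classes: a further vertex in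
  \<open>X\<close> has to pay for a further class. Level 0 always holds.\<close>

definition rich :: "'a set \<Rightarrow> 'a set set \<Rightarrow> nat \<Rightarrow> nat \<Rightarrow> bool" where
  "rich V E t s \<longleftrightarrow> (\<exists>X \<T>. X \<subseteq> V \<and> card X \<le> t \<and> finite \<T> \<and> card \<T> = t \<and>
     (\<forall>T\<in>\<T>. s \<le> card (trace_class V E X T)))"

lemma finite_trace_class: "finite V \<Longrightarrow> finite (trace_class V E X T)"
  by (simp add: trace_class_def)

text \<open>Otherwise adding \<open>v\<close> to \<open>X\<close> splits the class of \<open>T\<close> into two large classes, while every other
  class keeps a large half.\<close>
lemma sparse_or_dense:
  assumes sg: "simple_graph V E" and X: "X \<subseteq> V" "card X \<le> t"
    and \<T>: "finite \<T>" "card \<T> = t" "\<forall>T\<in>\<T>. 2 * d + 1 \<le> card (trace_class V E X T)"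
    and max: "\<not> rich V E (Suc t) d" and v: "v \<in> V - X" and T: "T \<in> \<T>"
  shows "card {u \<in> trace_class V E X T. {u, v} \<in> E} \<le> d \<or> card {u \<in> trace_class V E X T. {u, v} \<notin> E} \<le> d"
proof (rule ccontr)
  assume neg: "\<not> ?thesis"
  have fin: "finite V" using sg by (simp add: simple_graph_def)
  have loopless: "{v} \<notin> E" using simple_graph_loopless[OF sg] .
  define X' where "X' = insert v X"
  \<comment> \<open>Each class is nonempty because of the summand 1 in the size bound, so its trace
    really lies in \<open>X\<close> and avoids \<open>v\<close>.\<close>
  have \<T>X: "S \<subseteq> X" if "S \<in> \<T>" for S
  proof -
    have "trace_class V E X S \<noteq> {}" using \<T>(3) that by force
    then show ?thesis by (auto simp: trace_class_def trace_def)
  qed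
  have vS: "v \<notin> S" if "S \<in> \<T>" for S using \<T>X[OF that] v by blast
  have tr: "trace E X' u = (if {u, v} \<in> E then insert v (trace E X u) else trace E X u)"
    and vtr: "v \<notin> trace E X u" for u
    using v by (auto simp: trace_def X'_def)
  have c1: "trace_class V E X' (insert v S) = {u \<in> trace_class V E X S. {u, v} \<in> E}" if "S \<in> \<T>" for S
  proof (rule set_eqI)
    fix u
    have "trace E X' u = insert v S \<longleftrightarrow> {u, v} \<in> E \<and> trace E X u = S"
      using insert_ident[OF vtr vS[OF that]] vtr[of u] by (auto simp: tr)
    moreover have "{u, v} \<in> E \<Longrightarrow> u \<noteq> v" using loopless by auto
    ultimately show "u \<in> trace_class V E X' (insert v S) \<longleftrightarrow> u \<in> {u \<in> trace_class V E X S. {u, v} \<in> E}"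
      by (auto simp: trace_class_def X'_def)
  qed
  have c0: "trace_class V E X' S = {u \<in> trace_class V E X S. {u, v} \<notin> E} - {v}" if "S \<in> \<T>" for S
  proof (rule set_eqI)
    fix u
    have "trace E X' u = S \<longleftrightarrow> {u, v} \<notin> E \<and> trace E X u = S"
      using vS[OF that] by (auto simp: tr)
    then show "u \<in> trace_class V E X' S \<longleftrightarrow> u \<in> {u \<in> trace_class V E X S. {u, v} \<notin> E} - {v}"
      by (auto simp: trace_class_def X'_def)
  qed
  \<comment> \<open>Of the two parts of a class, one that keeps \<open>d\<close> vertices. The odd
    vertex of \<open>2 * d + 1\<close> pays for \<open>v\<close> itself, which leaves the class when
    it enters \<open>X\<close>.\<close>
  define g where "g S = (if d \<le> card (trace_class V E X' S) then S else insert v S)" for S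
  have g: "d \<le> card (trace_class V E X' (g S))" if S: "S \<in> \<T>" for S
  proof -
    have "trace_class V E X S \<subseteq> insert v (trace_class V E X' S \<union> trace_class V E X' (insert v S))"
      using c0[OF S] c1[OF S] by auto
    then have "card (trace_class V E X S) \<le> card (insert v (trace_class V E X' S \<union> trace_class V E X' (insert v S)))"
      using finite_trace_class[OF fin] by (intro card_mono) auto
    also have "\<dots> \<le> Suc (card (trace_class V E X' S \<union> trace_class V E X' (insert v S)))"
      by (rule card_insert_le_m1) auto
    also have "\<dots> \<le> Suc (card (trace_class V E X' S) + card (trace_class V E X' (insert v S)))"
      using card_Un_le by auto
    finally show ?thesis using \<T>(3) S by (fastforce simp: g_def)
  qed
  have gS: "g S - {v} = S" if "S \<in> \<T>" for S using vS[OF that] by (auto simp: g_def)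
  define \<T>' where "\<T>' = insert T (insert (insert v T) (g ` (\<T> - {T})))"
  have "inj_on g (\<T> - {T})" using gS by (intro inj_on_inverseI[where g = "\<lambda>S. S - {v}"]) auto
  then have "card (g ` (\<T> - {T})) = t - 1" using \<T> T by (simp add: card_image)
  moreover have "T \<noteq> insert v T" using vS[OF T] by blast
  moreover have "g S - {v} \<noteq> T" if "S \<in> \<T> - {T}" for S using gS that by auto
  then have "T \<notin> g ` (\<T> - {T})" "insert v T \<notin> g ` (\<T> - {T})" using vS[OF T] by auto
  moreover have "0 < t" using \<T> T card_gt_0_iff by blast
  ultimately have "card \<T>' = Suc t" using \<T>(1) by (simp add: \<T>'_def)
  moreover have "d \<le> card (trace_class V E X' S)" if S: "S \<in> \<T>'" for S
  proof -
    consider "S = T" | "S = insert v T" | S' where "S' \<in> \<T>" "S = g S'"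
      using S unfolding \<T>'_def by blast
    then show ?thesis
    proof cases
      case 1
      have "card {u \<in> trace_class V E X T. {u, v} \<notin> E} - 1 \<le> card ({u \<in> trace_class V E X T. {u, v} \<notin> E} - {v})"
        by (simp add: card_Diff_singleton_if)
      moreover have "d < card {u \<in> trace_class V E X T. {u, v} \<notin> E}" using neg by simp
      ultimately have "d \<le> card ({u \<in> trace_class V E X T. {u, v} \<notin> E} - {v})" by linarith
      then show ?thesis using 1 c0[OF T] by simp
    next
      case 2
      then show ?thesis using neg c1[OF T] by simp
    next
      case 3
      then show ?thesis using g by simp
    qed
  qed
  moreover have "card X' \<le> Suc t" using X card_insert_le_m1[of "Suc t" X v] by (simp add: X'_def)
  moreover have "X' \<subseteq> V" "finite \<T>'" using X v \<T> by (auto simp: X'_def \<T>'_def)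
  ultimately have "rich V E (Suc t) d" unfolding rich_def by blast
  with max show False ..
qed

text \<open>A further class of size \<open>d\<close> could join the family without enlarging
  \<open>X\<close>.\<close>

lemma small_class:
  assumes X: "X \<subseteq> V" "card X \<le> t" and \<T>: "finite \<T>" "card \<T> = t" "\<forall>T\<in>\<T>. d \<le> card (trace_class V E X T)"
    and max: "\<not> rich V E (Suc t) d" and T: "T \<notin> \<T>"
  shows "card (trace_class V E X T) < d"
proof (rule ccontr)
  assume "\<not> ?thesis"
  then have "rich V E (Suc t) d"
    unfolding rich_def using X \<T> T
    by (intro exI[of _ X] exI[of _ "insert T \<T>"]) auto
  with max show False ..
qed

text \<open>Every pair satisfies \<open>P\<close> or its negation, so the product of the sizes is at
  most \<open>d\<close> times their sum, which is impossible when both exceed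
  \<open>2 * d\<close>.\<close>

lemma double_count_le:
  fixes P :: "'a \<Rightarrow> 'b \<Rightarrow> bool"
  assumes fin: "finite W" "finite W'"
    and "\<And>w. w \<in> W \<Longrightarrow> card {x \<in> W'. P w x} \<le> d" "\<And>x. x \<in> W' \<Longrightarrow> card {w \<in> W. \<not> P w x} \<le> d"
  shows "card W \<le> 2 * d \<or> card W' \<le> 2 * d"
proof (rule ccontr)
  assume neg: "\<not> ?thesis"
  have "of_bool (P w x) + of_bool (\<not> P w x) = (1 :: nat)" for w x by simp
  then have "card W * card W' = (\<Sum>w\<in>W. \<Sum>x\<in>W'. of_bool (P w x) + of_bool (\<not> P w x))"
    by (simp del: of_bool_not_iff)
  also have "\<dots> = (\<Sum>w\<in>W. \<Sum>x\<in>W'. of_bool (P w x)) + (\<Sum>x\<in>W'. \<Sum>w\<in>W. of_bool (\<not> P w x))"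
    unfolding sum.distrib by (subst (2) sum.swap) simp
  also have "\<dots> = (\<Sum>w\<in>W. card {x \<in> W'. P w x}) + (\<Sum>x\<in>W'. card {w \<in> W. \<not> P w x})"
    using fin by (simp add: Int_def conj_commute)
  also have "\<dots> \<le> card W * d + card W' * d"
    using assms by (intro add_mono sum_bounded_above[where K = d, simplified]) auto
  finally have 1: "card W * card W' \<le> card W * d + card W' * d" .
  have "card W * (2 * d + 1) \<le> card W * card W'" using neg by (intro mult_left_mono) auto
  moreover have "(2 * d + 1) * card W' \<le> card W * card W'" using neg by (intro mult_right_mono) auto
  ultimately have "card W * (2 * d + 1) + (2 * d + 1) * card W' \<le> card W * card W' + card W * card W'"
    by (rule add_mono)
  also have "\<dots> \<le> (card W * d + card W' * d) + (card W * d + card W' * d)"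
    using 1 1 by (rule add_mono)
  finally show False using neg by (simp add: algebra_simps)
qed

lemma symmetric_colours_to_nat:
  fixes \<kappa> :: "'a \<Rightarrow> 'c"
  assumes "finite V" "card (\<kappa> ` V) \<le> l" "\<And>a b. K a b \<longleftrightarrow> K b a"
  obtains col :: "'a \<Rightarrow> nat" and K' where "\<And>v. v \<in> V \<Longrightarrow> col v < l" "\<And>a b. K' a b \<longleftrightarrow> K' b a"
    "\<And>u v. u \<in> V \<Longrightarrow> v \<in> V \<Longrightarrow> K' (col u) (col v) \<longleftrightarrow> K (\<kappa> u) (\<kappa> v)"
proof -
  have "card (\<kappa> ` V) \<le> card {..<l}" using assms by simp
  then obtain e where e: "inj_on e (\<kappa> ` V)" "e ` \<kappa> ` V \<subseteq> {..<l}"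
    using card_le_inj[of "\<kappa> ` V" "{..<l}"] assms(1) by auto
  define K' where "K' i j \<longleftrightarrow> (\<exists>u\<in>V. \<exists>v\<in>V. i = e (\<kappa> u) \<and> j = e (\<kappa> v) \<and> K (\<kappa> u) (\<kappa> v))" for i j
  show thesis
  proof (rule that[of "e \<circ> \<kappa>" K'])
    show "(e \<circ> \<kappa>) v < l" if "v \<in> V" for v using e that by auto
    show "K' a b \<longleftrightarrow> K' b a" for a b unfolding K'_def using assms(3) by blast
    show "K' ((e \<circ> \<kappa>) u) ((e \<circ> \<kappa>) v) \<longleftrightarrow> K (\<kappa> u) (\<kappa> v)" if "u \<in> V" "v \<in> V" for u v
      using that unfolding K'_def by (auto dest!: inj_onD[OF e(1)])
  qed
qed

text \<open>Given a rich family that cannot be enlarged, the bags are the sets of vertices with equal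
  trace and equal set of sparse classes. Vertices of \<open>X\<close>, of small classes and of small bags are
  boundedly many and get private colours, which then also record their neighbourhoods.\<close>
lemma flip_of_maximal_rich:
  fixes V :: "'a set"
  assumes sg: "simple_graph V E" and rich: "rich V E t (2 * d + 1)" and max: "\<not> rich V E (Suc t) d"
    and c: "c = t + 2 ^ t * d + t * 2 ^ t * (2 * d)"
  obtains col :: "'a \<Rightarrow> nat" and K where "\<And>v. v \<in> V \<Longrightarrow> col v < c + t * 2 ^ t * 2 ^ c"
    "\<And>a b. K a b \<longleftrightarrow> K b a"
    "\<And>u. u \<in> V \<Longrightarrow> card {v \<in> V. ({u, v} \<in> E) \<noteq> K (col u) (col v)} \<le> t * d"
proof -
  have fin: "finite V" using sg by (simp add: simple_graph_def)
  obtain X \<T> where X: "X \<subseteq> V" "card X \<le> t" and \<T>: "finite \<T>" "card \<T> = t"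
    "\<forall>T\<in>\<T>. 2 * d + 1 \<le> card (trace_class V E X T)"
    using rich unfolding rich_def by blast
  have finX: "finite X" using X fin finite_subset by blast
  define sp where "sp v = {T \<in> \<T>. card {u \<in> trace_class V E X T. {u, v} \<in> E} \<le> d}" for v
  define bag where "bag v = (trace E X v, sp v)" for v
  define B where "B = {v \<in> V - X. trace E X v \<in> \<T>}"
  have finB: "finite B" using fin by (simp add: B_def)
  have B_cls: "v \<in> trace_class V E X (trace E X v)" "trace E X v \<in> \<T>" "v \<in> V - X" if "v \<in> B" for v
    using that by (auto simp: B_def trace_class_def)
  have sparse: "card {u \<in> trace_class V E X T. {u, v} \<in> E} \<le> d" if "T \<in> sp v" for v T
    using that by (simp add: sp_def)
  have dense: "card {u \<in> trace_class V E X T. {u, v} \<notin> E} \<le> d" if "v \<in> B" "T \<in> \<T>" "T \<notin> sp v" for v T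
    using sparse_or_dense[OF sg X \<T> max B_cls(3)[OF that(1)] that(2)] that(2,3) by (auto simp: sp_def)
  have bag_range: "bag ` B \<subseteq> \<T> \<times> Pow \<T>" by (auto simp: bag_def sp_def B_def)
  have card_bags: "card (\<T> \<times> Pow \<T>) = t * 2 ^ t"
    using \<T> by (simp add: card_cartesian_product card_Pow)
  \<comment> \<open>The irregular vertices. The summands of \<open>c\<close> bound, in this order,
    \<open>X\<close>, the small classes and the small bags.\<close>
  define Z where "Z = V - {v \<in> B. 2 * d < card {w \<in> B. bag w = bag v}}"
  have "card Z \<le> c"
  proof -
    define S where "S = {b \<in> bag ` B. card {w \<in> B. bag w = b} \<le> 2 * d}"
    have "Z \<subseteq> X \<union> (\<Union>T\<in>Pow X - \<T>. trace_class V E X T) \<union> (\<Union>b\<in>S. {w \<in> B. bag w = b})"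
      by (auto simp: Z_def B_def S_def trace_class_def trace_def)
    then have "card Z \<le> card (X \<union> (\<Union>T\<in>Pow X - \<T>. trace_class V E X T) \<union> (\<Union>b\<in>S. {w \<in> B. bag w = b}))"
      using finX finB finite_trace_class[OF fin] by (intro card_mono) (auto simp: S_def)
    also have "\<dots> \<le> card X + card (\<Union>T\<in>Pow X - \<T>. trace_class V E X T) + card (\<Union>b\<in>S. {w \<in> B. bag w = b})"
      by (meson add_le_mono card_Un_le le_refl order_trans)
    also have "\<dots> \<le> t + 2 ^ t * d + t * 2 ^ t * (2 * d)"
    proof (intro add_mono)
      have "card (\<Union>T\<in>Pow X - \<T>. trace_class V E X T) \<le> (\<Sum>T\<in>Pow X - \<T>. card (trace_class V E X T))"
        using finX by (intro card_UN_le) simp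
      also have "\<dots> \<le> of_nat (card (Pow X - \<T>)) * d"
        using small_class[OF X \<T>(1,2) _ max] \<T>(3)
        by (intro sum_bounded_above) (fastforce intro: less_imp_le)
      also have "\<dots> \<le> 2 ^ t * d"
      proof -
        have "card (Pow X - \<T>) \<le> card (Pow X)" using finX by (intro card_mono) auto
        also have "\<dots> \<le> 2 ^ t" using finX X(2) by (simp add: card_Pow)
        finally show ?thesis by simp
      qed
      finally show "card (\<Union>T\<in>Pow X - \<T>. trace_class V E X T) \<le> 2 ^ t * d" .
      have finS: "finite S" using finB by (simp add: S_def)
      have "card (\<Union>b\<in>S. {w \<in> B. bag w = b}) \<le> (\<Sum>b\<in>S. card {w \<in> B. bag w = b})"
        using finS by (rule card_UN_le)
      also have "\<dots> \<le> of_nat (card S) * (2 * d)"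
        by (intro sum_bounded_above) (auto simp: S_def)
      also have "\<dots> \<le> t * 2 ^ t * (2 * d)"
      proof -
        have "card S \<le> card (\<T> \<times> Pow \<T>)"
          using bag_range \<T>(1) by (intro card_mono) (auto simp: S_def)
        then show ?thesis using card_bags by (simp del: mult.assoc)
      qed
      finally show "card (\<Union>b\<in>S. {w \<in> B. bag w = b}) \<le> t * 2 ^ t * (2 * d)" .
    qed (fact X(2))
    finally show ?thesis using c by simp
  qed
  have regular: "v \<in> B" "2 * d < card {w \<in> B. bag w = bag v}" if "v \<in> V" "v \<notin> Z" for v
    using that by (auto simp: Z_def)
  \<comment> \<open>Members of a bag agree on sparse classes. A conflict would give every vertex of
    one bag few neighbours in the other and every vertex of the other few non-neighbours back,
    against \<open>double_count_le\<close>.\<close>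
  have no_conflict: "trace E X u \<in> sp v"
    if u: "u \<in> V" "u \<notin> Z" and v: "v \<in> V" "v \<notin> Z" and uv: "trace E X v \<in> sp u" for u v
  proof (rule ccontr)
    assume neg: "trace E X u \<notin> sp v"
    have in_cls: "{w \<in> B. bag w = bag y} \<subseteq> trace_class V E X (trace E X y)" for y
      by (auto simp: bag_def trace_class_def B_def)
    have fin_cls: "finite {x \<in> trace_class V E X T. Q x}" for T Q
      using finite_trace_class[OF fin] by simp
    let ?W = "{w \<in> B. bag w = bag u}" and ?W' = "{w \<in> B. bag w = bag v}"
    have "card ?W \<le> 2 * d \<or> card ?W' \<le> 2 * d"
    proof (rule double_count_le[where P = "\<lambda>w x. {x, w} \<in> E"])
      show "finite ?W" "finite ?W'" using finB by auto
      fix w assume w: "w \<in> ?W"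
      have "card {x \<in> ?W'. {x, w} \<in> E} \<le> card {x \<in> trace_class V E X (trace E X v). {x, w} \<in> E}"
        using in_cls[of v] by (intro card_mono fin_cls) blast
      also have "\<dots> \<le> d" using w uv by (intro sparse) (auto simp: bag_def)
      finally show "card {x \<in> ?W'. {x, w} \<in> E} \<le> d" .
    next
      fix x assume x: "x \<in> ?W'"
      have "card {w \<in> ?W. {x, w} \<notin> E} \<le> card {w \<in> trace_class V E X (trace E X u). {w, x} \<notin> E}"
        using in_cls[of u] by (intro card_mono fin_cls) (auto simp: insert_commute)
      also have "\<dots> \<le> d" using x neg B_cls(2)[OF regular(1)[OF u]] by (intro dense) (auto simp: bag_def)
      finally show "card {w \<in> ?W. {x, w} \<notin> E} \<le> d" .
    qed
    then show False using regular(2)[OF u] regular(2)[OF v] by linarith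
  qed
  define \<kappa> where "\<kappa> v = (if v \<in> Z then Inl v else Inr (bag v, {z \<in> Z. {z, v} \<in> E}))" for v
  \<comment> \<open>The disjunction in the last case serves only to make \<open>K\<close> symmetric;
    by \<open>no_conflict\<close> its two sides agree on regular vertices.\<close>
  define K :: "'a + ('a set \<times> 'a set set) \<times> 'a set \<Rightarrow> 'a + ('a set \<times> 'a set set) \<times> 'a set \<Rightarrow> bool" where
    "K p q = (case p of
       Inl a \<Rightarrow> (case q of Inl b \<Rightarrow> {a, b} \<in> E | Inr (_, N) \<Rightarrow> a \<in> N)
     | Inr ((T, S), N) \<Rightarrow> (case q of Inl b \<Rightarrow> b \<in> N | Inr ((T', S'), _) \<Rightarrow> T' \<notin> S \<or> T \<notin> S'))" for p q
  have K_sym: "K p q \<longleftrightarrow> K q p" for p q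
    by (auto simp: K_def insert_commute split: sum.splits prod.splits)
  have ZV: "Z \<subseteq> V" by (auto simp: Z_def)
  then have finZ: "finite Z" using fin finite_subset by blast
  have card_colours: "card (\<kappa> ` V) \<le> c + t * 2 ^ t * 2 ^ c"
  proof -
    have "\<kappa> ` V \<subseteq> Inl ` Z \<union> Inr ` ((\<T> \<times> Pow \<T>) \<times> Pow Z)"
      using regular(1) bag_range by (fastforce simp: \<kappa>_def)
    then have "card (\<kappa> ` V) \<le> card (Inl ` Z \<union> Inr ` ((\<T> \<times> Pow \<T>) \<times> Pow Z)
        :: ('a + ('a set \<times> 'a set set) \<times> 'a set) set)"
      using finZ \<T>(1) by (intro card_mono) auto
    also have "\<dots> \<le> card (Inl ` Z :: ('a + ('a set \<times> 'a set set) \<times> 'a set) set)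
        + card (Inr ` ((\<T> \<times> Pow \<T>) \<times> Pow Z) :: ('a + ('a set \<times> 'a set set) \<times> 'a set) set)"
      by (rule card_Un_le)
    also have "\<dots> = card Z + t * 2 ^ t * 2 ^ card Z"
      using finZ card_bags by (simp add: card_image card_cartesian_product[of "\<T> \<times> Pow \<T>"] card_Pow)
    also have "\<dots> \<le> c + t * 2 ^ t * 2 ^ c"
      using \<open>card Z \<le> c\<close> by (intro add_mono mult_left_mono power_increasing) auto
    finally show ?thesis .
  qed
  obtain col :: "'a \<Rightarrow> nat" and K' where col: "\<And>v. v \<in> V \<Longrightarrow> col v < c + t * 2 ^ t * 2 ^ c"
    and K'_sym: "\<And>a b. K' a b \<longleftrightarrow> K' b a"
    and K': "\<And>u v. u \<in> V \<Longrightarrow> v \<in> V \<Longrightarrow> K' (col u) (col v) \<longleftrightarrow> K (\<kappa> u) (\<kappa> v)"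
    by (rule symmetric_colours_to_nat[where K = K, OF fin card_colours K_sym]) (rule that)
  have "card {v \<in> V. ({u, v} \<in> E) \<noteq> K' (col u) (col v)} \<le> t * d" if u: "u \<in> V" for u
  proof (cases "u \<in> Z")
    case True
    have "({u, v} \<in> E) = K' (col u) (col v)" if "v \<in> V" for v
      using True that by (auto simp: K'[OF u that] K_def \<kappa>_def)
    then have "{v \<in> V. ({u, v} \<in> E) \<noteq> K' (col u) (col v)} = {}" by blast
    then show ?thesis by (simp only: card.empty)
  next
    case False
    \<comment> \<open>Exceptions at a regular \<open>u\<close> lie in the \<open>t\<close> large
      classes, with at most \<open>d\<close> of them in each, whether sparse or dense.\<close>
    have "{v \<in> V. ({u, v} \<in> E) \<noteq> K' (col u) (col v)} \<subseteq>
        (\<Union>T\<in>\<T>. {v \<in> trace_class V E X T. ({v, u} \<in> E) \<noteq> (T \<notin> sp u)})"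
    proof
      fix v assume "v \<in> {v \<in> V. ({u, v} \<in> E) \<noteq> K' (col u) (col v)}"
      then have v: "v \<in> V" "({v, u} \<in> E) \<noteq> K (\<kappa> u) (\<kappa> v)" using K'[OF u] by (auto simp: insert_commute)
      have vZ: "v \<notin> Z" using v(2) False by (auto simp: K_def \<kappa>_def)
      have "K (\<kappa> u) (\<kappa> v) \<longleftrightarrow> trace E X v \<notin> sp u"
        using False vZ no_conflict[OF u False v(1) vZ] by (auto simp: K_def \<kappa>_def bag_def)
      then show "v \<in> (\<Union>T\<in>\<T>. {v \<in> trace_class V E X T. ({v, u} \<in> E) \<noteq> (T \<notin> sp u)})"
        using v B_cls[OF regular(1)[OF v(1) vZ]] by blast
    qed
    then have "card {v \<in> V. ({u, v} \<in> E) \<noteq> K' (col u) (col v)} \<le>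
        card (\<Union>T\<in>\<T>. {v \<in> trace_class V E X T. ({v, u} \<in> E) \<noteq> (T \<notin> sp u)})"
      using \<T>(1) finite_trace_class[OF fin] by (intro card_mono) auto
    also have "\<dots> \<le> (\<Sum>T\<in>\<T>. card {v \<in> trace_class V E X T. ({v, u} \<in> E) \<noteq> (T \<notin> sp u)})"
      using \<T>(1) by (rule card_UN_le)
    also have "\<dots> \<le> of_nat (card \<T>) * d"
    proof (rule sum_bounded_above)
      fix T assume "T \<in> \<T>"
      then show "card {v \<in> trace_class V E X T. ({v, u} \<in> E) \<noteq> (T \<notin> sp u)} \<le> d"
        using sparse[of T u] dense[OF regular(1)[OF u False], of T] by (cases "T \<in> sp u") auto
    qed
    finally show ?thesis using \<T>(2) by simp
  qed
  with col K'_sym show thesis by (rule that)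
qed

text \<open>Class size demanded when \<open>j\<close> levels of enlargement are still ahead; the
  recursion is the passage from \<open>2 * d + 1\<close> to \<open>d\<close> in
  \<open>sparse_or_dense\<close>.\<close>

fun threshold :: "nat \<Rightarrow> nat \<Rightarrow> nat" where
  "threshold k 0 = k"
| "threshold k (Suc j) = 2 * threshold k j + 1"

lemma threshold_mono: "i \<le> j \<Longrightarrow> threshold k i \<le> threshold k j"
  by (rule lift_Suc_mono_le[of "threshold k"]) simp_all

text \<open>\<open>l\<close> and \<open>D\<close> are uniform over the whole class; the exceptions
  at \<open>u\<close> are its neighbours in the flip, possibly together with \<open>u\<close>
  itself.\<close>

definition flip_bound :: "(nat set \<times> nat set set) list \<Rightarrow> nat \<Rightarrow> nat \<Rightarrow> bool" where
  "flip_bound Fs l D \<longleftrightarrow> (\<forall>V E. in_Free Fs V E \<longrightarrow> (\<exists>col :: nat \<Rightarrow> nat. \<exists>K.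
     (\<forall>v\<in>V. col v < l) \<and> (\<forall>a b. K a b \<longleftrightarrow> K b a) \<and>
     (\<forall>u\<in>V. card {v \<in> V. ({u, v} \<in> E) \<noteq> K (col u) (col v)} \<le> D)))"

lemma flip_bound_if_trace_bound:
  assumes bound: "trace_bound Fs m k"
  shows "\<exists>l D. flip_bound Fs l D"
proof -
  define d where "d = threshold k m"
  define c where "c = m + 2 ^ m * d + m * 2 ^ m * (2 * d)"
  have "\<exists>col :: nat \<Rightarrow> nat. \<exists>K. (\<forall>v\<in>V. col v < c + m * 2 ^ m * 2 ^ c) \<and> (\<forall>a b. K a b \<longleftrightarrow> K b a) \<and>
      (\<forall>u\<in>V. card {v \<in> V. ({u, v} \<in> E) \<noteq> K (col u) (col v)} \<le> m * d)"
    if free: "in_Free Fs V E" for V E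
  proof -
    have sg: "simple_graph V E" using free by (simp add: in_Free_def)
    have "\<not> rich V E m (threshold k 0)"
    proof
      assume "rich V E m (threshold k 0)"
      then obtain X \<T> where "X \<subseteq> V" "finite \<T>" "card \<T> = m" "\<forall>T\<in>\<T>. k \<le> card (trace_class V E X T)"
        unfolding rich_def by auto
      moreover from this have "card \<T> < m"
        using bound free unfolding trace_bound_def trace_class_def by blast
      ultimately show False by simp
    qed
    moreover have "rich V E 0 (threshold k (m - 0))"
      unfolding rich_def by (intro exI[of _ "{}"]) auto
    \<comment> \<open>Richness holds at level 0 and fails at level \<open>m\<close>, so it breaks at
      some step; there the family cannot be enlarged even with the weaker size demand.\<close>
    ultimately obtain t where t: "t < m" "rich V E t (threshold k (m - t))"
      "\<not> rich V E (Suc t) (threshold k (m - Suc t))"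
    proof -
      have "rich V E t (threshold k (m - t))" if "t \<le> m"
        and "\<And>t. t < m \<Longrightarrow> rich V E t (threshold k (m - t)) \<Longrightarrow> rich V E (Suc t) (threshold k (m - Suc t))" for t
        using that(1)
        by (induction t) (use \<open>rich V E 0 (threshold k (m - 0))\<close> that(2) in auto)
      from this[of m] \<open>\<not> rich V E m (threshold k 0)\<close> that show ?thesis by auto
    qed
    define d' where "d' = threshold k (m - Suc t)"
    have "m - t = Suc (m - Suc t)" using t(1) by simp
    then have "threshold k (m - t) = 2 * d' + 1" by (simp add: d'_def)
    then have rich: "rich V E t (2 * d' + 1)" and max: "\<not> rich V E (Suc t) d'"
      using t(2,3) by (simp_all add: d'_def)
    have d': "d' \<le> d" unfolding d_def d'_def by (rule threshold_mono) simp
    define c' where "c' = t + 2 ^ t * d' + t * 2 ^ t * (2 * d')"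
    have c': "c' \<le> c"
      unfolding c'_def c_def using t(1) d' by (intro add_mono mult_mono power_increasing) auto
    have l: "c' + t * 2 ^ t * 2 ^ c' \<le> c + m * 2 ^ m * 2 ^ c"
      using t(1) c' by (intro add_mono mult_mono power_increasing) auto
    have D: "t * d' \<le> m * d" using t(1) d' by (intro mult_mono) auto
    obtain col :: "nat \<Rightarrow> nat" and K where
      col: "\<And>v. v \<in> V \<Longrightarrow> col v < c' + t * 2 ^ t * 2 ^ c'" and "\<And>a b. K a b \<longleftrightarrow> K b a"
      and deg: "\<And>u. u \<in> V \<Longrightarrow> card {v \<in> V. ({u, v} \<in> E) \<noteq> K (col u) (col v)} \<le> t * d'"
      by (rule flip_of_maximal_rich[OF sg rich max c'_def]) (rule that)
    then show ?thesis
      using less_le_trans[OF col l] order_trans[OF deg D] by (intro exI[of _ col] exI[of _ K]) simp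
  qed
  then show ?thesis unfolding flip_bound_def by blast
qed

section \<open>Long paths in flips\<close>

text \<open>The ball of radius \<open>i\<close> around \<open>v\<close> in the graph with
  neighbourhoods \<open>N\<close>.\<close>

fun reach :: "('a \<Rightarrow> 'a set) \<Rightarrow> 'a \<Rightarrow> nat \<Rightarrow> 'a set" where
  "reach N v 0 = {v}"
| "reach N v (Suc i) = reach N v i \<union> \<Union> (N ` reach N v i)"

lemma reach_mono: "i \<le> j \<Longrightarrow> reach N v i \<subseteq> reach N v j"
  by (rule lift_Suc_mono_le[of "reach N v"]) auto

lemma reach_step: "x \<in> reach N v i \<Longrightarrow> y \<in> N x \<Longrightarrow> y \<in> reach N v (Suc i)"
  by auto

lemma card_reach_le:
  assumes N: "\<And>x. finite (N x) \<and> card (N x) \<le> D"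
  shows "finite (reach N v i) \<and> card (reach N v i) \<le> Suc D ^ i"
proof (induction i)
  case (Suc i)
  have "card (\<Union> (N ` reach N v i)) \<le> (\<Sum>x\<in>reach N v i. card (N x))"
    using Suc by (intro card_UN_le) simp
  also have "\<dots> \<le> of_nat (card (reach N v i)) * D"
    using N by (intro sum_bounded_above) blast
  also have "\<dots> \<le> Suc D ^ i * D" using Suc by simp
  finally have "card (\<Union> (N ` reach N v i)) \<le> Suc D ^ i * D" .
  moreover have "card (reach N v (Suc i)) \<le> card (reach N v i) + card (\<Union> (N ` reach N v i))"
    by (simp add: card_Un_le)
  ultimately have "card (reach N v (Suc i)) \<le> Suc D ^ i + Suc D ^ i * D" using Suc by linarith
  then show ?case using Suc N by (simp add: mult.commute)
qed simp

lemma shortest_path: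
  assumes "w \<in> reach N v i" "\<And>j. j < i \<Longrightarrow> w \<notin> reach N v j"
  obtains f where "f i = w" "\<And>a. a \<le> i \<Longrightarrow> f a \<in> reach N v a"
    "\<And>a b. a \<le> i \<Longrightarrow> b < a \<Longrightarrow> f a \<notin> reach N v b" "\<And>a. a < i \<Longrightarrow> f (Suc a) \<in> N (f a)"
proof -
  have "\<exists>f. f i = w \<and> (\<forall>a\<le>i. f a \<in> reach N v a \<and> (\<forall>b<a. f a \<notin> reach N v b)) \<and>
      (\<forall>a<i. f (Suc a) \<in> N (f a))"
    using assms
  proof (induction i arbitrary: w)
    case 0
    then show ?case by (intro exI[of _ "\<lambda>_. w"]) auto
  next
    case (Suc i)
    from Suc.prems(2)[of i] Suc.prems(1) obtain x where x: "x \<in> reach N v i" "w \<in> N x" by auto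
    have "x \<notin> reach N v j" if "j < i" for j
      using reach_step[of x N v j w] x(2) Suc.prems(2)[of "Suc j"] that by auto
    from Suc.IH[OF x(1) this] obtain f where f: "f i = x"
      "\<forall>a\<le>i. f a \<in> reach N v a \<and> (\<forall>b<a. f a \<notin> reach N v b)" "\<forall>a<i. f (Suc a) \<in> N (f a)"
      by blast
    have "(f(Suc i := w)) a \<in> reach N v a \<and> (\<forall>b<a. (f(Suc i := w)) a \<notin> reach N v b)" if "a \<le> Suc i" for a
      using f(2) Suc.prems that by (cases "a = Suc i") (auto simp del: reach.simps)
    moreover have "(f(Suc i := w)) (Suc a) \<in> N ((f(Suc i := w)) a)" if "a < Suc i" for a
      using f(1,3) x(2) that by (cases "a = i") auto
    ultimately show ?case by (intro exI[of _ "f(Suc i := w)"]) (simp del: reach.simps)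
  qed
  then show thesis using that by blast
qed

text \<open>A new vertex at distance \<open>i + 1\<close> gives a geodesic, and geodesics are
  induced: a chord would shorten the distance to \<open>v\<close>.\<close>

lemma induced_path_if_reach_grows:
  assumes sym: "\<And>x y. x \<in> N y \<longleftrightarrow> y \<in> N x" and irrefl: "\<And>x. x \<notin> N x"
    and grows: "reach N v (Suc i) \<noteq> reach N v i"
  obtains f where "inj_on f {..i}" "f ` {..i} \<subseteq> reach N v i"
    "\<And>a b. a \<le> i \<Longrightarrow> b \<le> i \<Longrightarrow> f a \<in> N (f b) \<longleftrightarrow> dist1 a b"
proof -
  obtain w where w: "w \<in> reach N v (Suc i)" "w \<notin> reach N v i" using grows by auto
  have "w \<notin> reach N v j" if "j < Suc i" for j
    using w(2) reach_mono[of j i N v] that by auto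
  from shortest_path[OF w(1) this] obtain f where f: "\<And>a. a \<le> Suc i \<Longrightarrow> f a \<in> reach N v a"
    "\<And>a b. a \<le> Suc i \<Longrightarrow> b < a \<Longrightarrow> f a \<notin> reach N v b" "\<And>a. a < Suc i \<Longrightarrow> f (Suc a) \<in> N (f a)"
    by metis
  have lt: "f b \<in> N (f a) \<longleftrightarrow> dist1 a b" if "a < b" "b \<le> i" for a b
  proof
    assume "f b \<in> N (f a)"
    then have "f b \<in> reach N v (Suc a)" using f(1)[of a] that by auto
    then have "\<not> Suc a < b" using f(2)[of b "Suc a"] that by auto
    then show "dist1 a b" using that by (auto simp: dist1_def)
  next
    assume "dist1 a b"
    then have "b = Suc a" using that by (auto simp: dist1_def)
    then show "f b \<in> N (f a)" using f(3)[of a] that by simp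
  qed
  show thesis
  proof (rule that[of f])
    show "inj_on f {..i}"
    proof (rule linorder_inj_onI)
      fix a b assume "a < b" "a \<in> {..i}" "b \<in> {..i}"
      then show "f a \<noteq> f b" using f(1)[of a] f(2)[of b a] by auto
    qed auto
    show "f ` {..i} \<subseteq> reach N v i"
    proof
      fix y assume "y \<in> f ` {..i}"
      then obtain a where "a \<le> i" "y = f a" by auto
      then show "y \<in> reach N v i" using f(1)[of a] reach_mono[of a i N v] by auto
    qed
    show "f a \<in> N (f b) \<longleftrightarrow> dist1 a b" if "a \<le> i" "b \<le> i" for a b
    proof (cases a b rule: linorder_cases)
      case less
      then show ?thesis using lt[of a b] that sym by metis
    next
      case equal
      then show ?thesis using irrefl by (auto simp: dist1_def)
    next
      case greater
      then show ?thesis using lt[of b a] that dist1_commute by metis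
    qed
  qed
qed

lemma large_fibre:
  assumes "finite S" "finite B" "g ` S \<subseteq> B" "card B * r < card S"
  obtains b where "r < card {s \<in> S. g s = b}"
proof (rule ccontr)
  assume "\<not> thesis"
  with that have le: "card {s \<in> S. g s = b} \<le> r" for b by (meson not_less)
  have "S = (\<Union>b\<in>B. {s \<in> S. g s = b})" using assms(3) by auto
  then have "card S \<le> (\<Sum>b\<in>B. card {s \<in> S. g s = b})" using card_UN_le[OF assms(2)] by metis
  also have "\<dots> \<le> of_nat (card B) * r" using le by (intro sum_bounded_above) blast
  finally show False using assms(4) by simp
qed

text \<open>Cutting a long path into blocks of length \<open>L\<close>, many blocks carry the same word of colours.\<close>
lemma strip_in_long_path:
  assumes f: "inj_on f {..i}" "f ` {..i} \<subseteq> V"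
    and col: "\<And>v. v \<in> V \<Longrightarrow> col v < l" and K_sym: "\<And>a b. K a b \<longleftrightarrow> K b a"
    and path: "\<And>a b. a \<le> i \<Longrightarrow> b \<le> i \<Longrightarrow> a \<noteq> b \<Longrightarrow>
      {f a, f b} \<in> E \<longleftrightarrow> K (col (f a)) (col (f b)) \<noteq> dist1 a b"
    and loopless: "\<And>x. {x} \<notin> E"
    and i: "i = Suc (l ^ L * L) * Suc L"
  shows "\<exists>HE. loop_graph L HE \<and> induced_sub (strip L HE L) (V, E)"
proof -
  \<comment> \<open>One block more than \<open>L\<close> for each of the \<open>l ^ L\<close> colour
    words, so some word occurs on more than \<open>L\<close> blocks.\<close>
  define J where "J = Suc (l ^ L * L)"
  define word where "word j = map (\<lambda>a. col (f (j * Suc L + a))) [1..<Suc L]" for j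
  have pos_le: "j * Suc L + a \<le> i" if "j < J" "a \<in> {1..L}" for j a
  proof -
    have "Suc j * Suc L \<le> J * Suc L" using that by (intro mult_right_mono) auto
    then show ?thesis using that by (simp add: i J_def)
  qed
  let ?B = "{xs. set xs \<subseteq> {..<l} \<and> length xs = L}"
  have "col (f (j * Suc L + a)) < l" if "j < J" "a \<in> {1..L}" for j a
    using pos_le[OF that] f(2) by (intro col) auto
  then have "word ` {..<J} \<subseteq> ?B" unfolding word_def by fastforce
  moreover have "card ?B * L < card {..<J}" by (simp add: card_lists_length_eq J_def)
  ultimately obtain xs where "L < card {j \<in> {..<J}. word j = xs}"
    using large_fibre[of "{..<J}" ?B word L] finite_lists_length_eq[of "{..<l}" L] by blast
  then obtain c where c: "inj_on c {1..L}" "c ` {1..L} \<subseteq> {j \<in> {..<J}. word j = xs}"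
    using card_le_inj[of "{1..L}" "{j \<in> {..<J}. word j = xs}"] by auto
  define HE where "HE = {{a, b} | a b. a \<in> {1..L} \<and> b \<in> {1..L} \<and> K (xs ! (a - 1)) (xs ! (b - 1))}"
  have HE_iff: "{a, b} \<in> HE \<longleftrightarrow> K (xs ! (a - 1)) (xs ! (b - 1))" if "a \<in> {1..L}" "b \<in> {1..L}" for a b
    using that K_sym unfolding HE_def by (auto simp: doubleton_eq_iff)
  \<comment> \<open>Blocks have length \<open>Suc L\<close> but use only the offsets 1 to
    \<open>L\<close>; the skipped offset 0 keeps vertices of different blocks from being
    consecutive.\<close>
  define pos where "pos a k = c k * Suc L + a" for a k
  have pos: "pos a k \<le> i \<and> col (f (pos a k)) = xs ! (a - 1)" if "a \<in> {1..L}" "k \<in> {1..L}" for a k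
  proof -
    have "c k \<in> {j \<in> {..<J}. word j = xs}" using c(2) that(2) by blast
    then have ck: "c k < J" "word (c k) = xs" by auto
    then have "xs ! (a - 1) = word (c k) ! (a - 1)" by simp
    also have "\<dots> = col (f (c k * Suc L + [1..<Suc L] ! (a - 1)))"
      unfolding word_def using that by (intro nth_map) auto
    also have "[1..<Suc L] ! (a - 1) = a" using that by (subst nth_upt) auto
    also have "col (f (c k * Suc L + a)) = col (f (pos a k))" by (simp add: pos_def)
    finally show ?thesis using pos_le[OF ck(1) that(1)] by (simp add: pos_def)
  qed
  have dist_pos: "dist1 (pos a k) (pos b k') \<longleftrightarrow> dist1 a b \<and> k = k'"
    and pos_eq: "pos a k = pos b k' \<longleftrightarrow> a = b \<and> k = k'"
    if ab: "a \<in> {1..L}" "b \<in> {1..L}" "k \<in> {1..L}" "k' \<in> {1..L}" for a b k k'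
  proof -
    have far: "pos a k + 2 \<le> pos b k'" if "a \<in> {1..L}" "b \<in> {1..L}" "c k < c k'" for a b k k'
    proof -
      have "Suc (c k) * Suc L \<le> c k' * Suc L" using that by (intro mult_right_mono) auto
      then show ?thesis using that by (simp add: pos_def)
    qed
    have "c k = c k' \<longleftrightarrow> k = k'" using inj_on_eq_iff[OF c(1)] ab by blast
    then consider "k = k'" | "k \<noteq> k'" "c k < c k'" | "k \<noteq> k'" "c k' < c k" by linarith
    then have "(dist1 (pos a k) (pos b k') \<longleftrightarrow> dist1 a b \<and> k = k') \<and>
        (pos a k = pos b k' \<longleftrightarrow> a = b \<and> k = k')"
    proof cases
      case 1
      then show ?thesis by (auto simp: pos_def dist1_def)
    next
      case 2
      then show ?thesis using far[of a b k k'] ab by (auto simp: dist1_def)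
    next
      case 3
      then show ?thesis using far[of b a k' k] ab by (auto simp: dist1_def)
    qed
    then show "dist1 (pos a k) (pos b k') \<longleftrightarrow> dist1 a b \<and> k = k'"
      "pos a k = pos b k' \<longleftrightarrow> a = b \<and> k = k'" by auto
  qed
  have "induced_sub (strip L HE L) (V, E)"
    unfolding induced_sub_def fst_strip fst_conv snd_conv
  proof (intro exI[of _ "\<lambda>(a, k). f (pos a k)"] conjI ballI)
    show "inj_on (\<lambda>(a, k). f (pos a k)) ({1..L} \<times> {1..L})"
    proof (rule inj_onI, clarify)
      fix a k b k' assume ab: "a \<in> {1..L}" "k \<in> {1..L}" "b \<in> {1..L}" "k' \<in> {1..L}"
        and "f (pos a k) = f (pos b k')"
      then have "pos a k = pos b k'" using pos inj_onD[OF f(1)] by simp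
      then show "a = b \<and> k = k'" using pos_eq ab by blast
    qed
    show "(\<lambda>(a, k). f (pos a k)) ` ({1..L} \<times> {1..L}) \<subseteq> V" using f(2) pos by auto
    fix x y assume "x \<in> {1..L} \<times> {1..L}" "y \<in> {1..L} \<times> {1..L}"
    then obtain a k b k' where xy: "x = (a, k)" "y = (b, k')"
      and ab: "a \<in> {1..L}" "k \<in> {1..L}" "b \<in> {1..L}" "k' \<in> {1..L}" by blast
    have "{f (pos a k), f (pos b k')} \<in> E \<longleftrightarrow> (a, k) \<noteq> (b, k') \<and> ({a, b} \<in> HE \<longleftrightarrow> \<not> (dist1 a b \<and> k = k'))"
    proof (cases "(a, k) = (b, k')")
      case True
      then show ?thesis using loopless by simp
    next
      case False
      then have "pos a k \<noteq> pos b k'" using pos_eq ab by blast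
      then have "{f (pos a k), f (pos b k')} \<in> E \<longleftrightarrow> K (xs ! (a - 1)) (xs ! (b - 1)) \<noteq> (dist1 a b \<and> k = k')"
        using path[of "pos a k" "pos b k'"] pos[of a k] pos[of b k'] dist_pos[of a b k k'] ab by simp
      then show ?thesis using HE_iff[of a b] ab False by blast
    qed
    then show "{x, y} \<in> snd (strip L HE L) \<longleftrightarrow>
        {case x of (a, k) \<Rightarrow> f (pos a k), case y of (a, k) \<Rightarrow> f (pos a k)} \<in> E"
      using ab by (simp add: xy doubleton_in_strip_iff)
  qed
  moreover have "loop_graph L HE" by (auto simp: loop_graph_def HE_def)
  ultimately show ?thesis by blast
qed

section \<open>Counting graphs with small components\<close>

text \<open>A ball that has stopped growing contains the whole component of its centre.\<close>

lemma reach_stable: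
  assumes "reach N v (Suc i) = reach N v i" "(v, x) \<in> {(u, w). w \<in> N u}\<^sup>*"
  shows "x \<in> reach N v i"
  using assms(2)
proof induction
  case base
  then show ?case using reach_mono[of 0 i N v] by auto
next
  case (step y z)
  then show ?case using reach_step[of y N v i z] assms(1) by auto
qed

text \<open>Fix a set of at least n/M fixed points in at most \<open>2 ^ n\<close> ways and map the
  other vertices arbitrarily.\<close>

lemma card_functions_with_fixed_points:
  assumes "0 < n"
  shows "real (card {p \<in> {1..n} \<rightarrow>\<^sub>E {1..n}. n \<le> M * card {v \<in> {1..n}. p v = v}})
    \<le> 2 ^ n * real n powr (real n - real n / real M)"
proof (cases "M = 0")
  case True
  then show ?thesis using assms by simp
next
  case False
  let ?F = "\<lambda>S. PiE {1..n} (\<lambda>v. if v \<in> S then {v} else {1..n})"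
  let ?S = "{S \<in> Pow {1..n}. n \<le> M * card S}"
  have fin: "finite (?F S)" for S by (intro finite_PiE) auto
  have "{p \<in> {1..n} \<rightarrow>\<^sub>E {1..n}. n \<le> M * card {v \<in> {1..n}. p v = v}} \<subseteq> (\<Union>S\<in>?S. ?F S)"
  proof
    fix p assume "p \<in> {p \<in> {1..n} \<rightarrow>\<^sub>E {1..n}. n \<le> M * card {v \<in> {1..n}. p v = v}}"
    then have p: "p \<in> {1..n} \<rightarrow>\<^sub>E {1..n}" "n \<le> M * card {v \<in> {1..n}. p v = v}" by auto
    have "p \<in> ?F {v \<in> {1..n}. p v = v}" using p(1) by (auto simp: PiE_def Pi_def)
    moreover have "{v \<in> {1..n}. p v = v} \<in> ?S" using p(2) by auto
    ultimately show "p \<in> (\<Union>S\<in>?S. ?F S)" by blast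
  qed
  then have "card {p \<in> {1..n} \<rightarrow>\<^sub>E {1..n}. n \<le> M * card {v \<in> {1..n}. p v = v}} \<le> card (\<Union>S\<in>?S. ?F S)"
    using fin by (intro card_mono) auto
  also have "\<dots> \<le> (\<Sum>S\<in>?S. card (?F S))" by (intro card_UN_le) simp
  finally have "real (card {p \<in> {1..n} \<rightarrow>\<^sub>E {1..n}. n \<le> M * card {v \<in> {1..n}. p v = v}})
      \<le> real (\<Sum>S\<in>?S. card (?F S))" by (rule of_nat_mono)
  also have "\<dots> = (\<Sum>S\<in>?S. real (card (?F S)))" by (rule of_nat_sum)
  also have "\<dots> \<le> of_nat (card ?S) * (real n powr (real n - real n / real M))"
  proof (rule sum_bounded_above)
    fix S assume S: "S \<in> ?S"
    have "card (?F S) = (\<Prod>v\<in>{1..n}. if v \<in> S then 1 else n)"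
      unfolding card_PiE[OF finite_atLeastAtMost] by (rule prod.cong) auto
    also have "\<dots> = n ^ card ({1..n} - S)"
      by (simp add: prod.If_cases Diff_eq)
    also have "card ({1..n} - S) = n - card S"
      using S by (subst card_Diff_subset) (auto intro: finite_subset)
    finally have "real (card (?F S)) = real n powr real (n - card S)"
      using assms by (simp add: powr_realpow)
    also have "\<dots> \<le> real n powr (real n - real n / real M)"
    proof (rule powr_mono)
      have "card S \<le> n" using S card_mono[of "{1..n}" S] by simp
      moreover have "real n \<le> real M * real (card S)" using S by (metis (lifting) mem_Collect_eq of_nat_le_iff of_nat_mult)
      then have "real n / real M \<le> real (card S)" using False by (simp add: field_simps)
      ultimately show "real (n - card S) \<le> real n - real n / real M" by (simp add: of_nat_diff)
      show "1 \<le> real n" using assms by simp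
    qed
    finally show "real (card (?F S)) \<le> real n powr (real n - real n / real M)" .
  qed
  also have "\<dots> \<le> 2 ^ n * real n powr (real n - real n / real M)"
  proof (intro mult_right_mono)
    have "card ?S \<le> card (Pow {1..n})" by (intro card_mono) auto
    then show "real (card ?S) \<le> 2 ^ n"
      by (simp add: card_Pow)
  qed simp
  finally show ?thesis .
qed

lemma not_above_Bell_if_speed_le:
  assumes M: "0 < M" and C: "0 \<le> C"
    and speed: "\<And>n. 0 < n \<Longrightarrow> real (speed Fs n) \<le> C ^ n * real n powr (real n - real n / real M)"
  shows "\<not> above_Bell Fs"
proof
  \<comment> \<open>Half of the saving 1/M: the other half is spent on absorbing
    \<open>C ^ n\<close>.\<close>
  define \<epsilon> where "\<epsilon> = 1 / (2 * real M)"
  have \<epsilon>: "0 < \<epsilon>" using M by (simp add: \<epsilon>_def)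
  assume "above_Bell Fs"
  then have "\<forall>\<^sub>F n in sequentially. real (speed Fs n) \<ge> real n powr ((1 - \<epsilon>) * real n)"
    using \<epsilon> unfolding above_Bell_def by blast
  moreover have "((\<lambda>n. real n powr (- \<epsilon>)) \<longlongrightarrow> 0) sequentially"
    using \<epsilon> by (intro tendsto_neg_powr filterlim_real_sequentially) auto
  then have "\<forall>\<^sub>F n in sequentially. real n powr (- \<epsilon>) < 1 / (C + 1)"
    using C by (intro order_tendstoD(2)[of _ "0"]) auto
  moreover have "\<forall>\<^sub>F n in sequentially. (1::nat) \<le> n" by (rule eventually_ge_at_top)
  ultimately have "\<forall>\<^sub>F n :: nat in sequentially. False"
  proof eventually_elim
    case (elim n)
    then have n: "0 < real n" "0 < n" by auto
    have "C + 1 < real n powr \<epsilon>" using elim(2) C n by (simp add: powr_minus field_simps)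
    then have Cn: "C < real n powr \<epsilon>" by simp
    have "real n powr ((1 - \<epsilon>) * real n) \<le> C ^ n * real n powr (real n - real n / real M)"
      using elim(1) speed[OF n(2)] by linarith
    also have "\<dots> < (real n powr \<epsilon>) ^ n * real n powr (real n - real n / real M)"
      using Cn C n by (intro mult_strict_right_mono power_strict_mono) auto
    also have "(real n powr \<epsilon>) ^ n = real n powr (\<epsilon> * real n)"
      using n by (simp add: powr_powr flip: powr_realpow)
    also have "real n powr (\<epsilon> * real n) * real n powr (real n - real n / real M) =
        real n powr (\<epsilon> * real n + (real n - real n / real M))"
      by (simp add: powr_add)
    also have "\<epsilon> * real n + (real n - real n / real M) = (1 - \<epsilon>) * real n"
      using M by (simp add: \<epsilon>_def field_simps)
    finally show False by simp
  qed
  then show False by simp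
qed

text \<open>A graph is determined by the relation \<open>Q\<close> between colours, the colouring, the function \<open>p\<close>
  picking a representative of each component of the flip, and inside the components by the rank
  of each vertex together with the set of ranks of its neighbours.\<close>
definition decode :: "nat \<Rightarrow> (nat \<times> nat) set \<times> (nat \<Rightarrow> nat) \<times> (nat \<Rightarrow> nat) \<times> (nat \<Rightarrow> nat) \<times> (nat \<Rightarrow> nat set)
    \<Rightarrow> nat set set" where
  "decode n = (\<lambda>(Q, p, col, rank, nbs). {{u, v} | u v. u \<in> {1..n} \<and> v \<in> {1..n} \<and> u \<noteq> v \<and>
     (if p u = p v then rank v \<in> nbs u else (col u, col v) \<in> Q)})"

text \<open>Only the choice of \<open>p\<close> is more than exponential in \<open>n\<close>. Its
  fixed points are the representatives, at least one for every \<open>M\<close> vertices.\<close>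

definition codes :: "nat \<Rightarrow> nat \<Rightarrow> nat \<Rightarrow>
    ((nat \<times> nat) set \<times> (nat \<Rightarrow> nat) \<times> (nat \<Rightarrow> nat) \<times> (nat \<Rightarrow> nat) \<times> (nat \<Rightarrow> nat set)) set" where
  "codes n l M = Pow ({..<l} \<times> {..<l})
     \<times> {p \<in> {1..n} \<rightarrow>\<^sub>E {1..n}. n \<le> M * card {v \<in> {1..n}. p v = v}}
     \<times> ({1..n} \<rightarrow>\<^sub>E {..<l}) \<times> ({1..n} \<rightarrow>\<^sub>E {..<M}) \<times> ({1..n} \<rightarrow>\<^sub>E Pow {..<M})"

lemma finite_codes: "finite (codes n l M)"
proof -
  have "finite {p \<in> {1..n} \<rightarrow>\<^sub>E {1..n}. n \<le> M * card {v \<in> {1..n}. p v = v}}"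
    by (rule finite_subset[of _ "{1..n} \<rightarrow>\<^sub>E {1..n}"]) (auto intro: finite_PiE)
  then show ?thesis unfolding codes_def by (intro finite_cartesian_product finite_PiE) auto
qed

lemma card_codes_le:
  assumes "0 < n"
  shows "real (card (codes n l M)) \<le>
    real (2 ^ (l * l) * (2 * l * M * 2 ^ M)) ^ n * real n powr (real n - real n / real M)"
proof -
  let ?P = "{p \<in> {1..n} \<rightarrow>\<^sub>E {1..n}. n \<le> M * card {v \<in> {1..n}. p v = v}}"
  have "card (codes n l M) = 2 ^ (l * l) * (card ?P * (l ^ n * (M ^ n * (2 ^ M) ^ n)))"
    unfolding codes_def by (simp add: card_cartesian_product card_Pow card_PiE)
  then have "real (card (codes n l M)) = 2 ^ (l * l) * (real (card ?P) * real (l * M * 2 ^ M) ^ n)"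
    by (simp add: power_mult_distrib)
  also have "\<dots> \<le> (2 ^ (l * l)) ^ n * ((2 ^ n * real n powr (real n - real n / real M)) * real (l * M * 2 ^ M) ^ n)"
    using card_functions_with_fixed_points[OF assms, of M] assms
    by (intro mult_mono self_le_power) auto
  also have "\<dots> = real (2 ^ (l * l) * (2 * l * M * 2 ^ M)) ^ n * real n powr (real n - real n / real M)"
    by (simp add: power_mult_distrib)
  finally show ?thesis .
qed

lemma graph_in_decode_codes:
  assumes sg: "simple_graph {1..n} E" and l: "\<And>v. v \<in> {1..n} \<Longrightarrow> col v < l"
    and A: "A = {(u, v). u \<in> {1..n} \<and> v \<in> {1..n} \<and> u \<noteq> v \<and> ({u, v} \<in> E) \<noteq> K (col u) (col v)}"
    and K_sym: "\<And>a b. K a b \<longleftrightarrow> K b a"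
    and comp: "\<And>v. v \<in> {1..n} \<Longrightarrow> card (A\<^sup>* `` {v}) \<le> M"
  shows "E \<in> decode n ` codes n l M"
proof -
  define C where "C v = A\<^sup>* `` {v}" for v
  have "sym A" using K_sym by (auto simp: A sym_def insert_commute)
  then have symA: "sym (A\<^sup>*)" by (rule sym_rtrancl)
  have C_self: "v \<in> C v" for v by (simp add: C_def)
  have C_eq: "C u = C v" if "u \<in> C v" for u v
  proof -
    have "(v, u) \<in> A\<^sup>*" "(u, v) \<in> A\<^sup>*" using that symA by (auto simp: C_def sym_def)
    then show ?thesis unfolding C_def by (auto intro: rtrancl_trans)
  qed
  have C_sub: "C v \<subseteq> {1..n}" if "v \<in> {1..n}" for v
  proof
    fix x assume "x \<in> C v"
    then have "(v, x) \<in> A\<^sup>*" by (simp add: C_def)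
    then show "x \<in> {1..n}" using that by induction (auto simp: A)
  qed
  have finC: "finite (C v)" if "v \<in> {1..n}" for v using C_sub[OF that] finite_subset by blast
  have cardC: "card (C v) \<le> M" if "v \<in> {1..n}" for v using comp[OF that] by (simp add: C_def)
  define p where "p = restrict (\<lambda>v. Min (C v)) {1..n}"
  have p_in: "p v \<in> C v" if "v \<in> {1..n}" for v
    using that Min_in[OF finC[OF that]] C_self[of v] by (auto simp: p_def)
  have p_eq_iff: "p u = p v \<longleftrightarrow> u \<in> C v" if uv: "u \<in> {1..n}" "v \<in> {1..n}" for u v
  proof
    assume "p u = p v"
    then have "C u = C v" using C_eq p_in uv by metis
    then show "u \<in> C v" using C_self by blast
  next
    assume "u \<in> C v"
    then have "C u = C v" by (rule C_eq)
    then show "p u = p v" using uv by (simp add: p_def)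
  qed
  define rank where "rank = restrict (\<lambda>v. card {x \<in> C v. x < v}) {1..n}"
  have rank_less: "rank v < M" if v: "v \<in> {1..n}" for v
  proof -
    have "card {x \<in> C v. x < v} < card (C v)"
      using finC[OF v] C_self[of v] by (intro psubset_card_mono) auto
    then show ?thesis using cardC[OF v] v by (simp add: rank_def)
  qed
  have rank_inj: "u = v" if uv: "u \<in> {1..n}" "v \<in> {1..n}" "u \<in> C v" "rank u = rank v" for u v
  proof (rule ccontr)
    have lt: "rank x < rank y" if "x \<in> {1..n}" "y \<in> {1..n}" "C x = C y" "x < y" for x y
    proof -
      have "card {z \<in> C x. z < x} < card {z \<in> C y. z < y}"
        using finC[OF that(1)] C_self[of x] that by (intro psubset_card_mono) auto
      then show ?thesis using that by (simp add: rank_def)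
    qed
    assume "u \<noteq> v"
    then show False using lt[of u v] lt[of v u] C_eq[OF uv(3)] uv by force
  qed
  define nbs where "nbs = restrict (\<lambda>u. {rank x | x. x \<in> C u \<and> {u, x} \<in> E}) {1..n}"
  define Q where "Q = {(a, b). a < l \<and> b < l \<and> K a b}"
  \<comment> \<open>The components of the representatives cover all vertices, and each has at most
    \<open>M\<close> of them.\<close>
  have "n \<le> M * card {v \<in> {1..n}. p v = v}"
  proof -
    have "{1..n} \<subseteq> (\<Union>q\<in>{v \<in> {1..n}. p v = v}. C q)"
    proof
      fix v assume v: "v \<in> {1..n}"
      have "p v \<in> {1..n}" using p_in[OF v] C_sub[OF v] by blast
      moreover from this have "p (p v) = p v" using p_eq_iff[of "p v" v] p_in[OF v] v by blast
      moreover have "v \<in> C (p v)" using C_eq[OF p_in[OF v]] C_self by blast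
      ultimately show "v \<in> (\<Union>q\<in>{v \<in> {1..n}. p v = v}. C q)" by blast
    qed
    then have "card {1..n} \<le> card (\<Union>q\<in>{v \<in> {1..n}. p v = v}. C q)"
      using finC by (intro card_mono) auto
    also have "\<dots> \<le> (\<Sum>q\<in>{v \<in> {1..n}. p v = v}. card (C q))" by (intro card_UN_le) simp
    also have "\<dots> \<le> of_nat (card {v \<in> {1..n}. p v = v}) * M"
      using cardC by (intro sum_bounded_above) auto
    finally show ?thesis by (simp add: mult.commute)
  qed
  moreover have "p \<in> {1..n} \<rightarrow>\<^sub>E {1..n}"
    unfolding PiE_iff
  proof
    show "\<forall>v\<in>{1..n}. p v \<in> {1..n}" using p_in C_sub by blast
    show "p \<in> extensional {1..n}" by (simp add: p_def)
  qed
  moreover have "restrict col {1..n} \<in> {1..n} \<rightarrow>\<^sub>E {..<l}" using l by auto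
  moreover have "rank \<in> {1..n} \<rightarrow>\<^sub>E {..<M}" using rank_less by (auto simp: rank_def)
  moreover have "nbs \<in> {1..n} \<rightarrow>\<^sub>E Pow {..<M}"
    unfolding PiE_iff
  proof
    show "\<forall>v\<in>{1..n}. nbs v \<in> Pow {..<M}"
    proof (intro ballI PowI subsetI)
      fix v r assume v: "v \<in> {1..n}" and "r \<in> nbs v"
      then obtain x where "x \<in> C v" "r = rank x" by (auto simp: nbs_def)
      then show "r \<in> {..<M}" using rank_less C_sub[OF v] by blast
    qed
    show "nbs \<in> extensional {1..n}" by (simp add: nbs_def)
  qed
  moreover have "Q \<subseteq> {..<l} \<times> {..<l}" by (auto simp: Q_def)
  ultimately have code: "(Q, p, restrict col {1..n}, rank, nbs) \<in> codes n l M" by (simp add: codes_def)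
  have adj: "{u, v} \<in> E \<longleftrightarrow> (if p u = p v then rank v \<in> nbs u else (restrict col {1..n} u, restrict col {1..n} v) \<in> Q)"
    if uv: "u \<in> {1..n}" "v \<in> {1..n}" "u \<noteq> v" for u v
  proof (cases "p u = p v")
    case True
    then have v: "v \<in> C u" using p_eq_iff[of v u] uv by simp
    have "rank v \<in> nbs u \<longleftrightarrow> {u, v} \<in> E"
    proof
      assume "rank v \<in> nbs u"
      then obtain x where x: "x \<in> C u" "{u, x} \<in> E" "rank x = rank v" using uv by (auto simp: nbs_def)
      have "x = v" using rank_inj[of x v] x v C_eq[OF v] C_sub[OF uv(1)] uv by blast
      then show "{u, v} \<in> E" using x by simp
    next
      assume "{u, v} \<in> E"
      then show "rank v \<in> nbs u" using v uv(1) unfolding nbs_def by auto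
    qed
    then show ?thesis using True by simp
  next
    case False
    \<comment> \<open>Between different components the flip has no edges, so adjacency equals the
      colour relation there.\<close>
    then have "(v, u) \<notin> A" using p_eq_iff[of u v] uv by (auto simp: C_def)
    then have "(u, v) \<notin> A" using \<open>sym A\<close> by (meson symD)
    then have "{u, v} \<in> E \<longleftrightarrow> K (col u) (col v)" using uv by (simp add: A)
    then show ?thesis using False uv l by (simp add: Q_def)
  qed
  have "decode n (Q, p, restrict col {1..n}, rank, nbs) = E"
  proof (rule set_eqI)
    fix e
    have "e \<in> decode n (Q, p, restrict col {1..n}, rank, nbs) \<longleftrightarrow>
        (\<exists>u v. e = {u, v} \<and> u \<in> {1..n} \<and> v \<in> {1..n} \<and> u \<noteq> v \<and> {u, v} \<in> E)"
      unfolding decode_def prod.case mem_Collect_eq using adj by blast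
    also have "\<dots> \<longleftrightarrow> e \<in> E" using sg unfolding simple_graph_def by blast
    finally show "e \<in> decode n (Q, p, restrict col {1..n}, rank, nbs) \<longleftrightarrow> e \<in> E" .
  qed
  with code show ?thesis by (metis image_eqI)
qed

lemma not_above_Bell_if_stop_no:
  assumes fin: "\<not> k_infinite Fs" and no: "stop_no Fs L"
  shows "\<not> above_Bell Fs"
proof -
  obtain m k where "trace_bound Fs m k" using trace_bound_if_not_k_infinite[OF fin] by blast
  then obtain l D where flip: "flip_bound Fs l D" using flip_bound_if_trace_bound by blast
  \<comment> \<open>The path length demanded by \<open>strip_in_long_path\<close>. Balls of radius
    \<open>i\<close> must then be whole components, and \<open>M\<close> bounds their size when
    degrees are at most \<open>D\<close>.\<close>
  define i where "i = Suc (l ^ L * L) * Suc L"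
  define M where "M = Suc D ^ i"
  have "E \<in> decode n ` codes n l M" if free: "in_Free Fs {1..n} E" for n E
  proof -
    have sg: "simple_graph {1..n} E" using free by (simp add: in_Free_def)
    obtain col :: "nat \<Rightarrow> nat" and K where col: "\<forall>v\<in>{1..n}. col v < l" and K_sym: "\<forall>a b. K a b \<longleftrightarrow> K b a"
      and deg: "\<forall>u\<in>{1..n}. card {v \<in> {1..n}. ({u, v} \<in> E) \<noteq> K (col u) (col v)} \<le> D"
      using flip free unfolding flip_bound_def by blast
    define A where "A = {(u, v). u \<in> {1..n} \<and> v \<in> {1..n} \<and> u \<noteq> v \<and> ({u, v} \<in> E) \<noteq> K (col u) (col v)}"
    define N where "N u = {v. (u, v) \<in> A}" for u
    have N: "finite (N u) \<and> card (N u) \<le> D" for u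
    proof (cases "u \<in> {1..n}")
      case True
      have "N u \<subseteq> {v \<in> {1..n}. ({u, v} \<in> E) \<noteq> K (col u) (col v)}" by (auto simp: N_def A_def)
      moreover have "finite {v \<in> {1..n}. ({u, v} \<in> E) \<noteq> K (col u) (col v)}" by simp
      ultimately show ?thesis using deg True by (meson card_mono finite_subset order_trans)
    next
      case False
      then have "N u = {}" by (auto simp: N_def A_def)
      then show ?thesis by simp
    qed
    have N_sym: "x \<in> N y \<longleftrightarrow> y \<in> N x" for x y using K_sym by (auto simp: N_def A_def insert_commute)
    have N_irrefl: "x \<notin> N x" for x by (auto simp: N_def A_def)
    have N_sub: "N x \<subseteq> {1..n}" for x by (auto simp: N_def A_def)
    have reach_sub: "reach N v j \<subseteq> {1..n}" if "v \<in> {1..n}" for v j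
      using that N_sub by (induction j) auto
    have "reach N v (Suc i) = reach N v i" if v: "v \<in> {1..n}" for v
    proof (rule ccontr)
      assume "reach N v (Suc i) \<noteq> reach N v i"
      from induced_path_if_reach_grows[OF N_sym N_irrefl this] obtain f where f: "inj_on f {..i}"
        "f ` {..i} \<subseteq> reach N v i" "\<And>a b. a \<le> i \<Longrightarrow> b \<le> i \<Longrightarrow> f a \<in> N (f b) \<longleftrightarrow> dist1 a b"
        by metis
      have fV: "f ` {..i} \<subseteq> {1..n}" using f(2) reach_sub[OF v] by blast
      have path: "{f a, f b} \<in> E \<longleftrightarrow> K (col (f a)) (col (f b)) \<noteq> dist1 a b"
        if "a \<le> i" "b \<le> i" "a \<noteq> b" for a b
      proof -
        have "f b \<noteq> f a" using inj_onD[OF f(1)] that by auto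
        moreover have "f a \<in> {1..n}" "f b \<in> {1..n}" using fV that by auto
        ultimately have "f b \<in> N (f a) \<longleftrightarrow> ({f a, f b} \<in> E) \<noteq> K (col (f a)) (col (f b))"
          by (simp add: N_def A_def)
        then show ?thesis using f(3)[OF that(2,1)] dist1_commute by blast
      qed
      have "\<exists>HE. loop_graph L HE \<and> induced_sub (strip L HE L) ({1..n}, E)"
      proof (rule strip_in_long_path[where col = col and K = K and l = l])
        show "col v < l" if "v \<in> {1..n}" for v using col that by blast
        show "K a b \<longleftrightarrow> K b a" for a b using K_sym by blast
      qed (fact f(1) fV path simple_graph_loopless[OF sg] i_def)+
      then obtain HE where "loop_graph L HE" "induced_sub (strip L HE L) ({1..n}, E)" by blast
      then show False
        using no free induced_sub_trans unfolding stop_no_def in_Free_def by blast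
    qed
    moreover have "{(u, w). w \<in> N u} = A" by (auto simp: N_def)
    ultimately have "A\<^sup>* `` {v} \<subseteq> reach N v i" if "v \<in> {1..n}" for v
      using reach_stable[of N v i] that by auto
    then have comp: "card (A\<^sup>* `` {v}) \<le> M" if "v \<in> {1..n}" for v
      using card_reach_le[of N D v i] N that unfolding M_def by (meson card_mono order_trans)
    show ?thesis
    proof (rule graph_in_decode_codes[where col = col and K = K, OF sg _ A_def _ comp])
      show "col v < l" if "v \<in> {1..n}" for v using col that by blast
      show "K a b \<longleftrightarrow> K b a" for a b using K_sym by blast
    qed
  qed
  then have "{E. in_Free Fs {1..n} E} \<subseteq> decode n ` codes n l M" for n by blast
  then have "speed Fs n \<le> card (codes n l M)" for n
    unfolding speed_def by (rule surj_card_le[OF finite_codes])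
  then have "real (speed Fs n) \<le> real (2 ^ (l * l) * (2 * l * M * 2 ^ M)) ^ n *
      real n powr (real n - real n / real M)" if "0 < n" for n
    using card_codes_le[OF that, of l M] by (meson of_nat_le_iff order_trans)
  then show ?thesis
    by (intro not_above_Bell_if_speed_le[of M "real (2 ^ (l * l) * (2 * l * M * 2 ^ M))"])
      (simp_all add: M_def del: of_nat_mult of_nat_power)
qed

theorem theorem4p8:
  fixes Fs :: "(nat set \<times> nat set set) list"
  assumes "\<forall>F\<in>set Fs. simple_graph (fst F) (snd F)"
  shows "algorithm Fs \<noteq> None \<and> (algorithm Fs = Some True \<longleftrightarrow> above_Bell Fs)"
proof (cases "k_infinite Fs")
  case True
  then show ?thesis using above_Bell_of_k_infinite by (simp add: algorithm_def)
next
  case False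
  let ?P = "\<lambda>l. 1 \<le> l \<and> (stop_no Fs l \<or> stop_yes Fs l)"
  have ex: "\<exists>l. ?P l" using stop_yes_if_never_stop_no[OF assms False] by blast
  define l where "l = (LEAST l. ?P l)"
  have l: "?P l" unfolding l_def using ex by (rule LeastI_ex)
  \<comment> \<open>Each answer is correct at every \<open>l\<close> separately, so nothing is used
    about the least \<open>l\<close> except that it stops the loop.\<close>
  have "above_Bell Fs \<longleftrightarrow> \<not> stop_no Fs l"
    using l above_Bell_if_stop_yes[OF assms] not_above_Bell_if_stop_no[OF False] by blast
  moreover have "algorithm Fs = Some (\<not> stop_no Fs l)"
    using False ex by (simp add: algorithm_def l_def)
  ultimately show ?thesis by simp
qed

end
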